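(* Let $\delta>0$ be a constant such that $\delta_n\le n/\delta+O(\log n)$ as $n\to\infty$. Then there are infinitely many $abc$ triples $(a,b,c)$ satisfying $$\exp\left(\frac{4\sqrt{2(\delta/e)\log c}}{\log\log c}\right)\operatorname{rad}(abc)\le c .$$
   Context: Three natural numbers $a,b,c$ (positive integers) form an $abc$ triple if they do not share a common factor and $a+b=c$. For a positive integer $N$, $\operatorname{rad}(N)=\prod_{p\mid N}p$ is the product of the distinct primes dividing $N$. For $n\ge 1$, $\delta_n$ denotes the smallest positive number such that every full-rank lattice $L\subset\mathbb{R}^n$ contains a nonzero vector $x$ with $\|x\|_1\le\delta_n\det(L)^{1/n}$, where $\|x\|_1=\sum_{i=1}^n|x_i|$ and $\det(L)$ is the volume (covolume) of $L$. Here $\log$ is the natural logarithm and $e$ is its base. *)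

theory Defs
  imports
    Complex_Main
    "HOL-Library.Landau_Symbols"
    "HOL-Computational_Algebra.Primes"
    "Jordan_Normal_Form.Determinant"
begin

definition abc_triple :: "nat \<Rightarrow> nat \<Rightarrow> nat \<Rightarrow> bool" where
  "abc_triple a b c \<longleftrightarrow> a > 0 \<and> b > 0 \<and> c > 0 \<and> Gcd {a, b, c} = 1 \<and> a + b = c"

definition rad :: "nat \<Rightarrow> nat" where
  "rad N = \<Prod>(prime_factors N)"

definition l1_norm :: "real vec \<Rightarrow> real" where
  "l1_norm x = (\<Sum>i<dim_vec x. \<bar>x $ i\<bar>)"

text \<open>The columns of \<open>B\<close> form a \<open>\<int>\<close>-basis of \<open>L\<close> and an \<open>\<real>\<close>-basis of \<open>\<real>\<^sup>n\<close>.
  Vectors of \<open>\<real>\<^sup>n\<close> are the elements of \<^term>\<open>carrier_vec n :: real vec set\<close>, because the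
  dimension varies within the statement.\<close>

definition lattice_basis :: "nat \<Rightarrow> real mat \<Rightarrow> real vec set \<Rightarrow> bool" where
  "lattice_basis n B L \<longleftrightarrow>
     B \<in> carrier_mat n n \<and> invertible_mat B \<and>
     L = {B *\<^sub>v map_vec real_of_int z | z. z \<in> carrier_vec n}"

definition full_rank_lattice :: "nat \<Rightarrow> real vec set \<Rightarrow> bool" where
  "full_rank_lattice n L \<longleftrightarrow> (\<exists>B. lattice_basis n B L)"

text \<open>The volume of the fundamental parallelepiped of any basis; see \<open>lattice_covolume_eq\<close> below
  for the independence of the basis.\<close>

definition lattice_covolume :: "nat \<Rightarrow> real vec set \<Rightarrow> real" where
  "lattice_covolume n L = (THE d. \<exists>B. lattice_basis n B L \<and> d = \<bar>det B\<bar>)"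

text \<open>For \<open>n \<ge> 1\<close> the least element exists: by Minkowski's theorem some constant works, and a
  limit of admissible constants is admissible since an \<open>\<ell>\<^sub>1\<close>-ball contains only finitely many
  points of a given lattice.\<close>

definition l1_lattice_const :: "nat \<Rightarrow> real" where
  "l1_lattice_const n = (LEAST d. d > 0 \<and>
     (\<forall>L. full_rank_lattice n L \<longrightarrow>
        (\<exists>x\<in>L. x \<noteq> 0\<^sub>v n \<and> l1_norm x \<le> d * lattice_covolume n L powr (1 / real n))))"

lemma lattice_basis_det_nonzero:
  assumes "lattice_basis n B L"
  shows "det B \<noteq> 0"
proof -
  from assms obtain C where B: "B \<in> carrier_mat n n"
    and BC: "B * C = 1\<^sub>m (dim_row B)" and CB: "C * B = 1\<^sub>m (dim_row C)"
    unfolding lattice_basis_def invertible_mat_def inverts_mat_def by auto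
  have "dim_col C = n"
    using arg_cong[OF BC, of dim_col] B by simp
  moreover have "dim_row C = n"
    using arg_cong[OF CB, of dim_col] B by simp
  ultimately have C: "C \<in> carrier_mat n n" by auto
  have "det B * det C = 1"
    using det_mult[OF B C] BC B by simp
  then show ?thesis by auto
qed

lemma lattice_basis_det_dvd:
  assumes B: "lattice_basis n B L" and C: "lattice_basis n C L"
  shows "\<exists>k. det C = det B * real_of_int k"
proof -
  from B C have carr: "B \<in> carrier_mat n n" "C \<in> carrier_mat n n"
    unfolding lattice_basis_def by auto
  have "\<exists>z. z \<in> carrier_vec n \<and> col C j = B *\<^sub>v map_vec real_of_int z" if j: "j < n" for j
  proof -
    have u: "map_vec real_of_int (unit_vec n j) = unit_vec n j"
      by (intro eq_vecI) (auto simp: unit_vec_def)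
    have "C *\<^sub>v map_vec real_of_int (unit_vec n j) = col C j"
      unfolding u using carr j by (intro eq_vecI) auto
    then have "col C j \<in> L"
      using C unfolding lattice_basis_def by (auto intro!: exI[of _ "unit_vec n j"])
    then show ?thesis
      using B unfolding lattice_basis_def by auto
  qed
  then obtain z where z: "\<And>j. j < n \<Longrightarrow> z j \<in> carrier_vec n"
      "\<And>j. j < n \<Longrightarrow> col C j = B *\<^sub>v map_vec real_of_int (z j)"
    by metis
  define U :: "int mat" where "U = mat n n (\<lambda>(i, j). z j $ i)"
  have U: "U \<in> carrier_mat n n" unfolding U_def by simp
  have "C = B * map_mat real_of_int U"
  proof (rule mat_col_eqI)
    fix j assume "j < dim_col (B * map_mat real_of_int U)"
    then have j: "j < n" using U by simp
    have "col (map_mat real_of_int U) j = map_vec real_of_int (z j)"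
      using z(1)[OF j] j unfolding U_def by (intro eq_vecI) auto
    then show "col C j = col (B * map_mat real_of_int U) j"
      using z(2)[OF j] carr U j by (subst col_mult2[of _ n n _ n]) auto
  qed (use carr U in auto)
  then have "det C = det B * real_of_int (det U)"
    using det_mult[OF carr(1), of "map_mat real_of_int U"] U by (simp add: of_int_hom.hom_det)
  then show ?thesis ..
qed

lemma lattice_covolume_eq:
  assumes B: "lattice_basis n B L"
  shows "lattice_covolume n L = \<bar>det B\<bar>"
  unfolding lattice_covolume_def
proof (rule the_equality)
  show "\<exists>B'. lattice_basis n B' L \<and> \<bar>det B\<bar> = \<bar>det B'\<bar>" using B by blast
next
  fix d assume "\<exists>C. lattice_basis n C L \<and> d = \<bar>det C\<bar>"
  then obtain C where C: "lattice_basis n C L" and d: "d = \<bar>det C\<bar>" by blast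
  obtain k where k: "det C = det B * real_of_int k"
    using lattice_basis_det_dvd[OF B C] by blast
  obtain l where l: "det B = det C * real_of_int l"
    using lattice_basis_det_dvd[OF C B] by blast
  have "det B * real_of_int (k * l) = det B"
    using k l by (metis of_int_mult mult.assoc)
  then have "real_of_int (k * l) = 1"
    using lattice_basis_det_nonzero[OF B] by simp
  then have "k * l = 1" by linarith
  then have "\<bar>k\<bar> = 1" by (auto simp: zmult_eq_1_iff)
  then have "\<bar>real_of_int k\<bar> = 1" by linarith
  then show "d = \<bar>det B\<bar>" unfolding d k by (simp add: abs_mult)
qed

end

(*
  For a set of n odd primes p, the integer vectors v with prod p^(v p) = 1 (mod 2^m) form a lattice
  of index at most 2^m. Scaling the coordinates by ln p and adding a coordinate
  sum (v p) ln p + k M, with M so large that k vanishes on short vectors, gives a full-rank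
  lattice in R^(n+1) on which the l1-norm is 2 ln (max X Y), where X / Y = prod p^(v p). A short
  vector thus yields a triple with c = max X Y whose difference |X - Y| is divisible by 2^m,
  so that rad(abc) <= 2^(1-m) c prod p.

  Taking all odd primes up to x and optimising m, the main terms of the inequality to be shown
  cancel, and it holds by a margin of relative order 1 / ln x for every x with
  sum_{p <= x} ln (x / p) > (x / ln x) (1 + 3 / (2 ln x)), provided that ln (2 delta) <= 3.
  No form of the prime number theorem is needed: were the displayed condition to fail for all large
  x, summation by parts would give sum_{p <= x} ln p / p <= ln x - (ln ln x) / 2 + O(1), against
  Mertens' lower bound. That delta <= 6 follows from lattices {v. q | a . v} with q prime and
  a chosen to avoid the at most 6^n integer vectors of l1-norm at most n.
*)
theory Submission
  imports Defs
    "HOL-Library.FuncSet"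
    "HOL-Number_Theory.Cong"
    "HOL-Number_Theory.Prime_Powers"
    "HOL-Real_Asymp.Real_Asymp"
begin

section \<open>Bases of integer lattices\<close>

text \<open>Why 3/2: the coefficient k in 1 + k / ln x has to lie strictly between 1 and 2.
  Summation by parts multiplies it by 1 - 2 / ln t, and the integral of (k - 2) / (t ln t) must tend
  to minus infinity, so k < 2. In the optimisation, expanding the exponent to be beaten costs 2 / ln
  x, of which the concavity of ln in the sum of ln ln p returns only 1 / ln x, so k > 1. The
  remaining 1/2 pays, a quarter each, for the second order terms of the expansion and for the lower
  order errors, among them the O(log n) of the hypothesis.

  The obstacle is that the number n of primes up to such an x is not known to be close to x / ln x.
  All estimates are therefore uniform in v = n ln x / x \<ge> 1 / ln x. This is also where ln (2
  \<delta>) \<le> 3 comes from: the cost above is the maximum over v of v (ln (2 \<delta>) - 1 - 2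
  ln v), which is 2 exp ((ln (2 \<delta>) - 3) / 2), hence at most 2 exactly under this
  condition.\<close>

definition int_lattice :: "nat \<Rightarrow> (nat \<Rightarrow> int) set \<Rightarrow> bool" where
  "int_lattice N \<Lambda> \<longleftrightarrow> (\<lambda>i. 0) \<in> \<Lambda> \<and> (\<forall>u\<in>\<Lambda>. \<forall>v\<in>\<Lambda>. (\<lambda>i. u i - v i) \<in> \<Lambda>) \<and>
     (\<forall>v\<in>\<Lambda>. \<forall>i\<ge>N. v i = 0)"

text \<open>A Hermite normal form without the reduction of off-diagonal entries; the product of the
  \<open>t j j\<close> is the index of \<Lambda> in the integer lattice. Coordinates are functions
  on all naturals, so that "vanishing above j" makes sense without truncating vectors. The
  divisibility clause records the minimality of \<open>t j j\<close>.\<close>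

definition triangular_basis :: "nat \<Rightarrow> (nat \<Rightarrow> nat \<Rightarrow> int) \<Rightarrow> (nat \<Rightarrow> int) set \<Rightarrow> bool" where
  "triangular_basis N t \<Lambda> \<longleftrightarrow>
     (\<forall>j<N. t j \<in> \<Lambda> \<and> (\<forall>i>j. t j i = 0) \<and> t j j > 0 \<and>
        (\<forall>v\<in>\<Lambda>. (\<forall>i>j. v i = 0) \<longrightarrow> t j j dvd v j)) \<and>
     \<Lambda> = {(\<lambda>i. \<Sum>j<N. c j * t j i) |c. True}"

lemma int_lattice_zero: "int_lattice N \<Lambda> \<Longrightarrow> (\<lambda>i. 0) \<in> \<Lambda>"
  and int_lattice_diff: "int_lattice N \<Lambda> \<Longrightarrow> u \<in> \<Lambda> \<Longrightarrow> v \<in> \<Lambda> \<Longrightarrow> (\<lambda>i. u i - v i) \<in> \<Lambda>"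
  and int_lattice_supp: "int_lattice N \<Lambda> \<Longrightarrow> v \<in> \<Lambda> \<Longrightarrow> i \<ge> N \<Longrightarrow> v i = 0"
  unfolding int_lattice_def by simp_all

lemma int_lattice_diff_mult:
  assumes \<Lambda>: "int_lattice N \<Lambda>" and u: "u \<in> \<Lambda>" and v: "v \<in> \<Lambda>"
  shows "(\<lambda>i. u i - c * v i) \<in> \<Lambda>"
proof (induction c rule: int_induct[where k = 0])
  case base
  show ?case using u by simp
next
  case (step1 c)
  from int_lattice_diff[OF \<Lambda> step1(2) v] show ?case by (simp add: algebra_simps)
next
  case (step2 c)
  from int_lattice_diff[OF \<Lambda> int_lattice_zero[OF \<Lambda>] v] have "(\<lambda>i. 0 - v i) \<in> \<Lambda>" .
  from int_lattice_diff[OF \<Lambda> step2(2) this] show ?case by (simp add: algebra_simps)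
qed

lemma int_lattice_sum_mult:
  assumes \<Lambda>: "int_lattice N \<Lambda>" and t: "\<And>j. j < (k :: nat) \<Longrightarrow> t j \<in> \<Lambda>"
  shows "(\<lambda>i. \<Sum>j<k. c j * t j i) \<in> \<Lambda>"
  using t
proof (induction k)
  case 0
  show ?case using int_lattice_zero[OF \<Lambda>] by simp
next
  case (Suc k)
  have "(\<lambda>i. (\<Sum>j<k. c j * t j i) - (- c k) * t k i) \<in> \<Lambda>"
    by (rule int_lattice_diff_mult[OF \<Lambda>]) (use Suc in simp_all)
  then show ?case by (simp add: algebra_simps)
qed

lemma triangular_basisD:
  assumes "triangular_basis N t \<Lambda>" and "j < N"
  shows "t j \<in> \<Lambda>" and "i > j \<Longrightarrow> t j i = 0" and "t j j > 0"
    and "v \<in> \<Lambda> \<Longrightarrow> \<forall>i>j. v i = 0 \<Longrightarrow> t j j dvd v j"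
  using assms(1)[unfolded triangular_basis_def, THEN conjunct1, THEN spec, THEN mp, OF assms(2)]
  by simp_all

text \<open>Take for \<open>t j\<close> a vector vanishing above j with least positive j-th
  coordinate. Division with remainder by \<open>t j j\<close> would otherwise produce a smaller one,
  which gives divisibility; clearing coordinates from the top down then gives spanning. The
  hypothesis \<open>pos\<close> expresses full rank.\<close>

lemma triangular_basis_exists:
  assumes \<Lambda>: "int_lattice N \<Lambda>"
    and pos: "\<And>j. j < N \<Longrightarrow> \<exists>v\<in>\<Lambda>. (\<forall>i>j. v i = 0) \<and> v j > 0"
  obtains t where "triangular_basis N t \<Lambda>"
proof -
  define Q where "Q j v \<longleftrightarrow> v \<in> \<Lambda> \<and> (\<forall>i>j. v i = 0) \<and> v j > 0" for j and v :: "nat \<Rightarrow> int"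
  have "\<exists>v. Q j v \<and> (\<forall>w. Q j w \<longrightarrow> nat (v j) \<le> nat (w j))" if "j < N" for j
  proof -
    from pos[OF that] obtain v where "Q j v" unfolding Q_def by blast
    then show ?thesis using ex_has_least_nat[of "Q j" v "\<lambda>v. nat (v j)"] by blast
  qed
  then obtain t where t: "\<And>j. j < N \<Longrightarrow> Q j (t j)"
    and least: "\<And>j w. j < N \<Longrightarrow> Q j w \<Longrightarrow> nat (t j j) \<le> nat (w j)"
    by metis
  have dvd: "t j j dvd v j" if j: "j < N" and v: "v \<in> \<Lambda>" and zero: "\<forall>i>j. v i = 0" for j v
  proof (rule ccontr)
    assume ndvd: "\<not> t j j dvd v j"
    define w where "w = (\<lambda>i. v i - (v j div t j j) * t j i)"
    have wj: "w j = v j mod t j j" unfolding w_def by (simp add: minus_div_mult_eq_mod)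
    have tj: "t j \<in> \<Lambda>" "t j j > 0" "\<forall>i>j. t j i = 0" using t[OF j] unfolding Q_def by auto
    have "w \<in> \<Lambda>" unfolding w_def by (rule int_lattice_diff_mult[OF \<Lambda> v tj(1)])
    moreover have "\<forall>i>j. w i = 0" using zero tj(3) unfolding w_def by simp
    moreover have "w j > 0" using ndvd tj(2) unfolding wj
      by (metis dvd_eq_mod_eq_0 order_le_less pos_mod_sign)
    ultimately have "nat (t j j) \<le> nat (w j)" using least[OF j, of w] unfolding Q_def by blast
    moreover have "w j < t j j" unfolding wj using tj(2) by simp
    ultimately show False using tj(2) by linarith
  qed
  have span: "\<exists>c. v = (\<lambda>i. \<Sum>j<k. c j * t j i)" if "k \<le> N" "v \<in> \<Lambda>" "\<forall>i\<ge>k. v i = 0" for k v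
    using that
  proof (induction k arbitrary: v)
    case 0
    then show ?case by auto
  next
    case (Suc k)
    then have k: "k < N" by simp
    have zero: "\<forall>i>k. v i = 0" using Suc.prems by simp
    obtain q where q: "v k = t k k * q" using dvd[OF k Suc.prems(2) zero] by blast
    have tk: "t k \<in> \<Lambda>" "\<forall>i>k. t k i = 0" using t[OF k] unfolding Q_def by auto
    define w where "w = (\<lambda>i. v i - q * t k i)"
    have "w \<in> \<Lambda>" unfolding w_def by (rule int_lattice_diff_mult[OF \<Lambda> Suc.prems(2) tk(1)])
    moreover have "\<forall>i\<ge>k. w i = 0"
      using q zero tk(2) unfolding w_def by (auto simp: le_less)
    ultimately obtain c where c: "w = (\<lambda>i. \<Sum>j<k. c j * t j i)"
      using Suc.IH[of w] k by auto
    have "v = (\<lambda>i. \<Sum>j<Suc k. (c(k := q)) j * t j i)"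
    proof
      fix i
      have "v i = w i + q * t k i" unfolding w_def by simp
      then show "v i = (\<Sum>j<Suc k. (c(k := q)) j * t j i)" unfolding c by simp
    qed
    then show ?case by blast
  qed
  have "\<exists>c. v = (\<lambda>i. \<Sum>j<N. c j * t j i)" if "v \<in> \<Lambda>" for v
    using span[of N v] int_lattice_supp[OF \<Lambda> that] that by auto
  moreover have tm: "t j \<in> \<Lambda>" if "j < N" for j using t[OF that] unfolding Q_def by simp
  ultimately have "\<Lambda> = {(\<lambda>i. \<Sum>j<N. c j * t j i) |c. True}"
    using int_lattice_sum_mult[OF \<Lambda>, of N t] by auto
  moreover have "\<forall>j<N. t j \<in> \<Lambda> \<and> (\<forall>i>j. t j i = 0) \<and> t j j > 0 \<and>
        (\<forall>v\<in>\<Lambda>. (\<forall>i>j. v i = 0) \<longrightarrow> t j j dvd v j)"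
  proof (intro allI impI conjI ballI)
    show "t j j dvd v j" if "j < N" "v \<in> \<Lambda>" "\<forall>i>j. v i = 0" for j v
      by (rule dvd) (use that in simp_all)
  qed (use t in \<open>simp_all add: Q_def\<close>)
  ultimately have "triangular_basis N t \<Lambda>" unfolding triangular_basis_def by blast
  then show thesis by (rule that)
qed

lemma invertible_mat_if_det_nonzero:
  fixes A :: "'a :: field mat"
  assumes A: "A \<in> carrier_mat n n" and det: "det A \<noteq> 0"
  obtains A' where "A' \<in> carrier_mat n n" "A * A' = 1\<^sub>m n" "A' * A = 1\<^sub>m n" "invertible_mat A"
proof -
  define A' where "A' = inverse (det A) \<cdot>\<^sub>m adj_mat A"
  note adj = adj_mat[OF A]
  have A': "A' \<in> carrier_mat n n" using adj unfolding A'_def by simp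
  have "A * A' = inverse (det A) \<cdot>\<^sub>m (A * adj_mat A)"
    unfolding A'_def by (rule mult_smult_distrib[OF A adj(1)])
  then have 1: "A * A' = 1\<^sub>m n" unfolding adj(2) using det by (intro eq_matI) auto
  have "A' * A = inverse (det A) \<cdot>\<^sub>m (adj_mat A * A)"
    unfolding A'_def by (rule mult_smult_assoc_mat[OF adj(1) A])
  then have 2: "A' * A = 1\<^sub>m n" unfolding adj(3) using det by (intro eq_matI) auto
  have "invertible_mat A" unfolding invertible_mat_def inverts_mat_def
    using A A' 1 2 by (intro conjI exI[of _ A']) auto
  from that[OF A' 1 2 this] show thesis .
qed

text \<open>With the \<open>t j\<close> as columns of an upper triangular matrix T, the image
  lattice has basis matrix A T, and det T is the product of the diagonal.\<close>

lemma lattice_of_triangular_basis: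
  assumes A: "A \<in> carrier_mat N N" and det: "det A \<noteq> 0"
    and t: "triangular_basis N t \<Lambda>"
  shows "\<exists>B. lattice_basis N B ((\<lambda>v. A *\<^sub>v vec N (\<lambda>i. real_of_int (v i))) ` \<Lambda>)
           \<and> \<bar>det B\<bar> = \<bar>det A\<bar> * (\<Prod>j<N. real_of_int (t j j))"
proof -
  note tri = triangular_basisD(2)[OF t] and pos = triangular_basisD(3)[OF t]
  have \<Lambda>: "\<Lambda> = {(\<lambda>i. \<Sum>j<N. c j * t j i) |c. True}"
    using t unfolding triangular_basis_def by simp
  define T where "T = mat N N (\<lambda>(i, j). real_of_int (t j i))"
  have T: "T \<in> carrier_mat N N" unfolding T_def by simp
  have "det T = prod_list (diag_mat T)"
    by (rule det_upper_triangular[OF _ T]) (auto simp: T_def tri)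
  also have "\<dots> = (\<Prod>j<N. real_of_int (t j j))"
    unfolding prod_list_diag_prod by (simp add: T_def atLeast0LessThan)
  finally have detT: "det T = (\<Prod>j<N. real_of_int (t j j))" .
  have posT: "det T > 0" unfolding detT using pos by (intro prod_pos) auto
  define B where "B = A * T"
  have B: "B \<in> carrier_mat N N" unfolding B_def using A T by simp
  have detB: "det B = det A * det T" unfolding B_def by (rule det_mult[OF A T])
  have inv: "invertible_mat B"
    using invertible_mat_if_det_nonzero[OF B] detB det posT by auto
  have comb: "B *\<^sub>v map_vec real_of_int z = A *\<^sub>v vec N (\<lambda>i. real_of_int (\<Sum>j<N. z $ j * t j i))"
    if z: "z \<in> carrier_vec N" for z
  proof -
    have "B *\<^sub>v map_vec real_of_int z = A *\<^sub>v (T *\<^sub>v map_vec real_of_int z)"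
      unfolding B_def using A T z by (intro assoc_mult_mat_vec) auto
    also have "T *\<^sub>v map_vec real_of_int z = vec N (\<lambda>i. real_of_int (\<Sum>j<N. z $ j * t j i))"
      using z unfolding T_def
      by (intro eq_vecI) (auto simp: scalar_prod_def atLeast0LessThan mult.commute)
    finally show ?thesis .
  qed
  have "(\<lambda>v. A *\<^sub>v vec N (\<lambda>i. real_of_int (v i))) ` \<Lambda>
      = {B *\<^sub>v map_vec real_of_int z | z. z \<in> carrier_vec N}" (is "?L = ?R")
  proof (intro equalityI subsetI)
    fix x assume "x \<in> ?L"
    then obtain c where x: "x = A *\<^sub>v vec N (\<lambda>i. real_of_int (\<Sum>j<N. c j * t j i))"
      unfolding \<Lambda> by auto
    have "x = B *\<^sub>v map_vec real_of_int (vec N c)"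
      unfolding comb[of "vec N c", OF vec_carrier] x by simp
    then show "x \<in> ?R" by (auto intro!: exI[of _ "vec N c"])
  next
    fix x assume "x \<in> ?R"
    then obtain z where z: "z \<in> carrier_vec N" and x: "x = B *\<^sub>v map_vec real_of_int z" by blast
    show "x \<in> ?L" unfolding x comb[OF z] \<Lambda>
      by (rule image_eqI[where x = "\<lambda>i. \<Sum>j<N. z $ j * t j i"]) auto
  qed
  then have "lattice_basis N B ((\<lambda>v. A *\<^sub>v vec N (\<lambda>i. real_of_int (v i))) ` \<Lambda>)"
    unfolding lattice_basis_def using B inv by simp
  moreover have "\<bar>det B\<bar> = \<bar>det A\<bar> * (\<Prod>j<N. real_of_int (t j j))"
    using detB detT posT by (simp add: abs_mult)
  ultimately show ?thesis by blast
qed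

text \<open>Coset labels are only read off on these vectors, because the label used for the prime
  lattice, \<open>prime_product\<close>, truncates negative exponents.\<close>

definition nonneg_vecs :: "nat \<Rightarrow> (nat \<Rightarrow> int) set" where
  "nonneg_vecs N = {u. (\<forall>i. u i \<ge> 0) \<and> (\<forall>i\<ge>N. u i = 0)}"

text \<open>The box with sides \<open>t j j\<close> contains no two congruent points, so the
  labelling f is injective on it: at the highest coordinate where two points differ, the difference
  would be a multiple of \<open>t j j\<close> of smaller absolute value.\<close>

lemma prod_diagonal_le_card:
  fixes f :: "(nat \<Rightarrow> int) \<Rightarrow> 'b"
  assumes t: "triangular_basis N t \<Lambda>"
    and fin: "finite D"
    and f: "\<forall>u\<in>nonneg_vecs N. f u \<in> D"
    and inj: "\<forall>u\<in>nonneg_vecs N. \<forall>v\<in>nonneg_vecs N. f u = f v \<longrightarrow> (\<lambda>i. u i - v i) \<in> \<Lambda>"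
  shows "(\<Prod>j<N. t j j) \<le> int (card D)"
proof -
  note pos = triangular_basisD(3)[OF t] and dvd = triangular_basisD(4)[OF t]
  define X where "X = Pi\<^sub>E {..<N} (\<lambda>j. {0..<t j j})"
  define e where "e x = (\<lambda>i. if i < N then x i else 0)" for x :: "nat \<Rightarrow> int"
  have e: "e x \<in> nonneg_vecs N" if "x \<in> X" for x
    using that unfolding e_def X_def nonneg_vecs_def by (auto simp: PiE_def Pi_def)
  have "inj_on (\<lambda>x. f (e x)) X"
  proof (rule inj_onI, rule ccontr)
    fix x y assume x: "x \<in> X" and y: "y \<in> X" and fe: "f (e x) = f (e y)" and ne: "x \<noteq> y"
    define J where "J = {j. j < N \<and> x j \<noteq> y j}"
    have "J \<noteq> {}"
      using ne PiE_ext[of x "{..<N}" "\<lambda>j. {0..<t j j}" y] x y unfolding J_def X_def by blast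
    moreover have finJ: "finite J" unfolding J_def by simp
    ultimately have JM: "Max J \<in> J" by simp
    define j where "j = Max J"
    have j: "j < N" "x j \<noteq> y j" using JM unfolding j_def J_def by auto
    have "i \<notin> J" if "i > j" for i using Max_ge[OF finJ, of i] that unfolding j_def by auto
    then have z: "\<forall>i>j. e x i - e y i = 0" unfolding e_def J_def by auto
    have "(\<lambda>i. e x i - e y i) \<in> \<Lambda>" using bspec[OF bspec[OF inj e[OF x]] e[OF y]] fe by simp
    from dvd[OF j(1) this z] have "t j j dvd x j - y j" using j unfolding e_def by simp
    moreover have "x j \<in> {0..<t j j}" "y j \<in> {0..<t j j}"
      using x y j unfolding X_def by (auto simp: PiE_def Pi_def)
    then have "\<bar>x j - y j\<bar> < t j j" by auto
    ultimately show False using j(2) using dvd_imp_le_int[of "x j - y j" "t j j"] pos[OF j(1)] by simp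
  qed
  moreover have "(\<lambda>x. f (e x)) ` X \<subseteq> D" using e f by auto
  ultimately have "card X \<le> card D" using fin by (metis card_inj_on_le)
  moreover have "int (card X) = (\<Prod>j<N. t j j)"
    unfolding X_def using pos by (subst card_PiE) (auto simp: less_imp_le)
  ultimately show ?thesis by linarith
qed

text \<open>A labelling with finitely many values whose equality implies congruence bounds the index
  by the number of labels. It also yields full rank, by pigeonhole on multiples of a unit
  vector.\<close>

lemma kernel_lattice:
  fixes f :: "(nat \<Rightarrow> int) \<Rightarrow> 'b"
  assumes A: "A \<in> carrier_mat N N" and det: "det A \<noteq> 0"
    and \<Lambda>: "int_lattice N \<Lambda>"
    and fin: "finite D"
    and f: "\<forall>u\<in>nonneg_vecs N. f u \<in> D"
    and inj: "\<forall>u\<in>nonneg_vecs N. \<forall>v\<in>nonneg_vecs N. f u = f v \<longrightarrow> (\<lambda>i. u i - v i) \<in> \<Lambda>"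
  defines "L \<equiv> (\<lambda>v. A *\<^sub>v vec N (\<lambda>i. real_of_int (v i))) ` \<Lambda>"
  shows "full_rank_lattice N L" and "lattice_covolume N L \<le> \<bar>det A\<bar> * card D"
    and "lattice_covolume N L > 0"
proof -
  have ex: "\<exists>v\<in>\<Lambda>. (\<forall>i>j. v i = 0) \<and> v j > 0" if j: "j < N" for j
  proof -
    define u where "u k = (\<lambda>i. if i = j then int k else 0)" for k :: nat
    have u: "u k \<in> nonneg_vecs N" for k using j unfolding u_def nonneg_vecs_def by auto
    \<comment> \<open>The multiples 0, ..., card D are one more than there are labels.\<close>
    have "\<not> inj_on (\<lambda>k. f (u k)) {..card D}"
    proof
      assume "inj_on (\<lambda>k. f (u k)) {..card D}"
      moreover have "(\<lambda>k. f (u k)) ` {..card D} \<subseteq> D" using f u by auto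
      ultimately have "card {..card D} \<le> card D" using fin by (metis card_inj_on_le)
      then show False by simp
    qed
    then obtain k l where kl: "f (u k) = f (u l)" "k \<noteq> l" unfolding inj_on_def by blast
    then obtain k l where kl: "f (u k) = f (u l)" "k < l" by (metis linorder_neqE_nat)
    have "(\<lambda>i. u l i - u k i) \<in> \<Lambda>" using bspec[OF bspec[OF inj u[of l]] u[of k]] kl by simp
    then show ?thesis using kl by (intro bexI[of _ "\<lambda>i. u l i - u k i"]) (auto simp: u_def)
  qed
  obtain t where t: "triangular_basis N t \<Lambda>" using triangular_basis_exists[OF \<Lambda> ex] by blast
  have "\<exists>B. lattice_basis N B L \<and> \<bar>det B\<bar> = \<bar>det A\<bar> * (\<Prod>j<N. real_of_int (t j j))"
    unfolding L_def by (rule lattice_of_triangular_basis[OF A det t])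
  then obtain B
    where B: "lattice_basis N B L" "\<bar>det B\<bar> = \<bar>det A\<bar> * (\<Prod>j<N. real_of_int (t j j))"
    by blast
  show "full_rank_lattice N L" using B(1) unfolding full_rank_lattice_def by blast
  have cov: "lattice_covolume N L = \<bar>det A\<bar> * real_of_int (\<Prod>j<N. t j j)"
    unfolding lattice_covolume_eq[OF B(1)] B(2) by simp
  show "lattice_covolume N L > 0"
    using lattice_basis_det_nonzero[OF B(1)] unfolding lattice_covolume_eq[OF B(1)] by simp
  have "(\<Prod>j<N. t j j) \<le> int (card D)"
    by (rule prod_diagonal_le_card[OF t fin f inj])
  then have "real_of_int (\<Prod>j<N. t j j) \<le> real (card D)" by linarith
  then show "lattice_covolume N L \<le> \<bar>det A\<bar> * card D"
    unfolding cov by (intro mult_left_mono) auto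
qed

section \<open>Pigeonhole modulo an integer lattice\<close>

lemma reduce_mod_triangular:
  assumes \<Lambda>: "int_lattice N \<Lambda>" and t: "triangular_basis N t \<Lambda>"
    and x: "\<And>i. i \<ge> N \<Longrightarrow> x i = 0"
  shows "\<exists>y. (\<lambda>i. x i - y i) \<in> \<Lambda> \<and> (\<forall>i<N. 0 \<le> y i \<and> y i < t i i) \<and> (\<forall>i\<ge>N. y i = 0)"
proof -
  note tri = triangular_basisD(2)[OF t] and pos = triangular_basisD(3)[OF t]
  have "\<exists>y. (\<lambda>i. x i - y i) \<in> \<Lambda> \<and> (\<forall>i<k. 0 \<le> y i \<and> y i < t i i) \<and> (\<forall>i\<ge>k. y i = 0)"
    if "k \<le> N" "\<forall>i\<ge>k. x i = 0" for k x
    using that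
  proof (induction k arbitrary: x)
    case 0
    then show ?case using int_lattice_zero[OF \<Lambda>] by (intro exI[of _ "\<lambda>i. 0"]) auto
  next
    case (Suc k)
    then have k: "k < N" by simp
    define q where "q = x k div t k k"
    \<comment> \<open>Coordinate k is cleared here and its residue is put back in \<open>y'\<close>;
      subtracting a multiple of \<open>t k\<close> only disturbs lower coordinates, left to the
      induction.\<close>
    define x' where "x' = (\<lambda>i. if i < k then x i - q * t k i else 0)"
    obtain y where y: "(\<lambda>i. x' i - y i) \<in> \<Lambda>" "\<forall>i<k. 0 \<le> y i \<and> y i < t i i" "\<forall>i\<ge>k. y i = 0"
      using Suc.IH[of x'] k unfolding x'_def by auto
    define y' where "y' = y(k := x k mod t k k)"
    have "(\<lambda>i. (x' i - y i) - (- q) * t k i) \<in> \<Lambda>"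
      by (rule int_lattice_diff_mult[OF \<Lambda> y(1) triangular_basisD(1)[OF t k]])
    moreover have "(\<lambda>i. (x' i - y i) - - q * t k i) = (\<lambda>i. x i - y' i)"
    proof
      fix i
      consider "i < k" | "i = k" | "i > k" by linarith
      then show "(x' i - y i) - - q * t k i = x i - y' i"
      proof cases
        case 2
        have "x k = q * t k k + x k mod t k k" unfolding q_def by simp
        then show ?thesis using 2 y(3) unfolding x'_def y'_def by simp
      next
        case 3
        then show ?thesis using y(3) tri[OF k] Suc.prems unfolding x'_def y'_def by simp
      qed (simp add: x'_def y'_def)
    qed
    ultimately have "(\<lambda>i. x i - y' i) \<in> \<Lambda>" by simp
    then show ?case using y pos[OF k] unfolding y'_def
      by (intro exI[of _ y']) (auto simp: y'_def less_Suc_eq)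
  qed
  from this[of N x] show ?thesis using x by auto
qed

lemma two_congruent_vectors:
  assumes \<Lambda>: "int_lattice N \<Lambda>" and t: "triangular_basis N t \<Lambda>"
    and X: "\<forall>x\<in>X. \<forall>i\<ge>N. x i = 0"
    and card: "int (card X) > (\<Prod>j<N. t j j)"
  shows "\<exists>x\<in>X. \<exists>y\<in>X. x \<noteq> y \<and> (\<lambda>i. x i - y i) \<in> \<Lambda>"
proof -
  have "\<exists>y. (\<lambda>i. x i - y i) \<in> \<Lambda> \<and> (\<forall>i<N. 0 \<le> y i \<and> y i < t i i) \<and> (\<forall>i\<ge>N. y i = 0)" if "x \<in> X" for x
    using X that by (intro reduce_mod_triangular[OF \<Lambda> t]) simp
  then have "\<forall>x\<in>X. \<exists>y. (\<lambda>i. x i - y i) \<in> \<Lambda> \<and> (\<forall>i<N. 0 \<le> y i \<and> y i < t i i) \<and> (\<forall>i\<ge>N. y i = 0)"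
    by simp
  from bchoice[OF this] obtain r where R: "\<forall>x\<in>X. (\<lambda>i. x i - r x i) \<in> \<Lambda> \<and>
      (\<forall>i<N. 0 \<le> r x i \<and> r x i < t i i) \<and> (\<forall>i\<ge>N. r x i = 0)" ..
  have r: "(\<lambda>i. x i - r x i) \<in> \<Lambda>" "i < N \<Longrightarrow> 0 \<le> r x i \<and> r x i < t i i"
    "i \<ge> N \<Longrightarrow> r x i = 0" if "x \<in> X" for x i
    using bspec[OF R that] by simp_all
  define Y where "Y = Pi\<^sub>E {..<N} (\<lambda>j. {0..<t j j})"
  have finY: "finite Y" unfolding Y_def by (intro finite_PiE) auto
  have "int (card Y) = (\<Prod>j<N. t j j)"
    unfolding Y_def using triangular_basisD(3)[OF t] by (subst card_PiE) (auto simp: less_imp_le)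
  moreover have "(\<lambda>x. restrict (r x) {..<N}) ` X \<subseteq> Y"
    unfolding Y_def using r(2) by (auto split: if_splits)
  ultimately have "\<not> inj_on (\<lambda>x. restrict (r x) {..<N}) X"
    using card card_inj_on_le[OF _ _ finY] by (metis linorder_not_le of_nat_mono)
  then obtain x y where xy: "x \<in> X" "y \<in> X" "x \<noteq> y"
    and eq: "restrict (r x) {..<N} = restrict (r y) {..<N}" unfolding inj_on_def by blast
  have "r x i = r y i" for i
  proof (cases "i < N")
    case True
    then show ?thesis using fun_cong[OF eq, of i] by simp
  qed (use r(3) xy in simp)
  then have "(\<lambda>i. (x i - r x i) - (y i - r y i)) = (\<lambda>i. x i - y i)" by simp
  then show ?thesis using int_lattice_diff[OF \<Lambda> r(1)[OF xy(1)] r(1)[OF xy(2)]] xy by auto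
qed

text \<open>Minkowski's argument in the sup norm, by counting: the cube with entries 0 to K has more
  points than the index |det A|, so two of them are congruent, and their difference has entries at
  most K in absolute value.\<close>

lemma short_vector_int_lattice:
  fixes A :: "int mat"
  assumes A: "A \<in> carrier_mat n n" and det: "det A \<noteq> 0"
    and K: "int (K + 1) ^ n > \<bar>det A\<bar>"
  obtains z where "z \<in> carrier_vec n" "z \<noteq> 0\<^sub>v n" "\<And>i. i < n \<Longrightarrow> \<bar>(A *\<^sub>v z) $ i\<bar> \<le> int K"
proof -
  define g where "g z = (\<lambda>i. if i < n then (A *\<^sub>v z) $ i else 0)" for z
  define \<Lambda> where "\<Lambda> = g ` carrier_vec n"
  have gdiff: "g (u - v) = (\<lambda>i. g u i - g v i)" if "u \<in> carrier_vec n" "v \<in> carrier_vec n" for u v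
    using that A unfolding g_def by (auto simp: fun_eq_iff mult_minus_distrib_mat_vec)
  have diff: "(\<lambda>i. u i - v i) \<in> \<Lambda>" if "u \<in> \<Lambda>" "v \<in> \<Lambda>" for u v
  proof -
    obtain x y where xy: "x \<in> carrier_vec n" "y \<in> carrier_vec n" "u = g x" "v = g y"
      using \<open>u \<in> \<Lambda>\<close> \<open>v \<in> \<Lambda>\<close> unfolding \<Lambda>_def by blast
    have "g (x - y) \<in> \<Lambda>" unfolding \<Lambda>_def using xy by (intro imageI) simp
    then show ?thesis unfolding gdiff[OF xy(1,2)] xy(3,4) .
  qed
  have "g (0\<^sub>v n) = (\<lambda>i. 0)" using A unfolding g_def by (auto simp: fun_eq_iff)
  then have zero: "(\<lambda>i. 0) \<in> \<Lambda>" unfolding \<Lambda>_def by (metis image_eqI zero_carrier_vec)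
  have ex: "\<exists>v\<in>\<Lambda>. (\<forall>i>j. v i = 0) \<and> v j > 0" if j: "j < n" for j
  proof -
    note adj = adj_mat[OF A]
    \<comment> \<open>Since A times its adjugate is det A times the identity, |det A| times the j-th
      unit vector lies in the lattice; the sign makes the entry positive.\<close>
    define w where "w = adj_mat A *\<^sub>v (sgn (det A) \<cdot>\<^sub>v unit_vec n j)"
    have w: "w \<in> carrier_vec n" unfolding w_def using adj by simp
    have "A *\<^sub>v w = (A * adj_mat A) *\<^sub>v (sgn (det A) \<cdot>\<^sub>v unit_vec n j)"
      unfolding w_def using A adj by (subst assoc_mult_mat_vec) auto
    also have "\<dots> = \<bar>det A\<bar> \<cdot>\<^sub>v unit_vec n j"
      unfolding adj(2) by (intro eq_vecI) (use j in \<open>auto simp: scalar_prod_def unit_vec_def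
        if_distrib[of "\<lambda>c. _ * c"] if_distrib[of "\<lambda>c. c * _"] abs_sgn cong: if_cong\<close>)
    finally have "g w = (\<lambda>i. if i = j then \<bar>det A\<bar> else 0)"
      using j unfolding g_def by (auto simp: fun_eq_iff unit_vec_def)
    then show ?thesis using w det unfolding \<Lambda>_def by (intro bexI[of _ "g w"] imageI) auto
  qed
  have lat: "int_lattice n \<Lambda>"
    unfolding int_lattice_def using zero diff by (auto simp: \<Lambda>_def g_def)
  obtain t where t: "triangular_basis n t \<Lambda>" using triangular_basis_exists[OF lat ex] by blast
  define L where "L = (\<lambda>v. 1\<^sub>m n *\<^sub>v vec n (\<lambda>i. real_of_int (v i))) ` \<Lambda>"
  have "\<exists>B. lattice_basis n B L \<and> \<bar>det B\<bar> = \<bar>det (1\<^sub>m n)\<bar> * (\<Prod>j<n. real_of_int (t j j))"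
    unfolding L_def by (rule lattice_of_triangular_basis[OF _ _ t]) simp_all
  then obtain B where B: "lattice_basis n B L" "\<bar>det B\<bar> = (\<Prod>j<n. real_of_int (t j j))" by auto
  \<comment> \<open>\<open>A\<close> itself and the triangular basis generate the same lattice, so
    independence of the covolume from the basis identifies |det A| with the product of the
    \<open>t j j\<close>.\<close>
  let ?A = "map_mat real_of_int A"
  have detA: "det ?A = real_of_int (det A)" by (rule of_int_hom.hom_det)
  have "lattice_basis n ?A L" unfolding lattice_basis_def
  proof (intro conjI)
    show A': "?A \<in> carrier_mat n n" using A by simp
    show "invertible_mat ?A"
      using invertible_mat_if_det_nonzero[OF A'] detA det by auto
    have "1\<^sub>m n *\<^sub>v vec n (\<lambda>i. real_of_int (g z i)) = ?A *\<^sub>v map_vec real_of_int z"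
      if "z \<in> carrier_vec n" for z
      using that A unfolding g_def by (intro eq_vecI) (auto simp: scalar_prod_def)
    then show "L = {?A *\<^sub>v map_vec real_of_int z |z. z \<in> carrier_vec n}"
      unfolding L_def \<Lambda>_def by (force simp: image_iff)
  qed
  then have "\<bar>det ?A\<bar> = \<bar>det B\<bar>" using lattice_covolume_eq B(1) by metis
  then have "real_of_int \<bar>det A\<bar> = real_of_int (\<Prod>j<n. t j j)" unfolding B(2) detA by simp
  then have prod: "\<bar>det A\<bar> = (\<Prod>j<n. t j j)" by linarith
  define e where "e x = (\<lambda>i. if i < n then x i else 0)" for x :: "nat \<Rightarrow> int"
  define X where "X = e ` (Pi\<^sub>E {..<n} (\<lambda>_. {0..int K}))"
  have "inj_on e (Pi\<^sub>E {..<n} (\<lambda>_. {0..int K}))"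
  proof (rule inj_onI)
    fix x y assume x: "x \<in> Pi\<^sub>E {..<n} (\<lambda>_. {0..int K})" and y: "y \<in> Pi\<^sub>E {..<n} (\<lambda>_. {0..int K})"
      and eq: "e x = e y"
    show "x = y"
    proof (rule PiE_ext[OF x y])
      show "x i = y i" if "i \<in> {..<n}" for i using fun_cong[OF eq, of i] that unfolding e_def by simp
    qed
  qed
  moreover have "nat (int K + 1) = K + 1" by simp
  ultimately have "card X = (K + 1) ^ n"
    unfolding X_def by (simp add: card_image card_PiE del: nat_int_add)
  then have card: "int (card X) > (\<Prod>j<n. t j j)" using K prod by simp
  have supp: "\<forall>x\<in>X. \<forall>i\<ge>n. x i = 0"
    unfolding X_def e_def by simp
  have "\<exists>x\<in>X. \<exists>y\<in>X. x \<noteq> y \<and> (\<lambda>i. x i - y i) \<in> \<Lambda>"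
    by (rule two_congruent_vectors[of n \<Lambda> t X, OF lat t supp card])
  then obtain x y where xy: "x \<in> X" "y \<in> X" "x \<noteq> y" "(\<lambda>i. x i - y i) \<in> \<Lambda>" by blast
  then obtain z where z: "z \<in> carrier_vec n" "(\<lambda>i. x i - y i) = g z" unfolding \<Lambda>_def by auto
  have bound: "\<bar>(A *\<^sub>v z) $ i\<bar> \<le> int K" if i: "i < n" for i
  proof -
    have "x i \<in> {0..int K}" "y i \<in> {0..int K}"
      using xy(1,2) i unfolding X_def e_def by (auto simp: PiE_def Pi_def)
    then have "\<bar>x i - y i\<bar> \<le> int K" by auto
    then show ?thesis using fun_cong[OF z(2), of i] i unfolding g_def by simp
  qed
  have "z \<noteq> 0\<^sub>v n"
    using z(2) \<open>g (0\<^sub>v n) = (\<lambda>i. 0)\<close> xy(3) by (metis eq_iff_diff_eq_0 ext)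
  with that z(1) bound show thesis by blast
qed

section \<open>Short vectors in real lattices\<close>

lemma tendsto_det:
  fixes A :: "nat \<Rightarrow> real mat"
  assumes A: "\<And>k. A k \<in> carrier_mat n n" and B: "B \<in> carrier_mat n n"
    and lim: "\<And>i j. i < n \<Longrightarrow> j < n \<Longrightarrow> (\<lambda>k. A k $$ (i, j)) \<longlonglongrightarrow> B $$ (i, j)"
  shows "(\<lambda>k. det (A k)) \<longlonglongrightarrow> det B"
proof -
  have "(\<lambda>k. \<Sum>p | p permutes {0..<n}. signof p * (\<Prod>i = 0..<n. A k $$ (i, p i)))
      \<longlonglongrightarrow> (\<Sum>p | p permutes {0..<n}. signof p * (\<Prod>i = 0..<n. B $$ (i, p i)))"
    by (intro tendsto_sum tendsto_mult tendsto_const tendsto_prod lim)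
       (auto simp: permutes_in_image)
  then show ?thesis unfolding det_def'[OF A] det_def'[OF B] .
qed

text \<open>From z = C (B z); the sum of all |entries| of C serves as a crude operator norm. It
  bounds the coefficients of short lattice vectors.\<close>

lemma l1_norm_le_inverse:
  fixes B C :: "real mat"
  assumes B: "B \<in> carrier_mat n n" and C: "C \<in> carrier_mat n n" and CB: "C * B = 1\<^sub>m n"
    and z: "z \<in> carrier_vec n" and i: "i < n"
  shows "\<bar>z $ i\<bar> \<le> (\<Sum>i<n. \<Sum>j<n. \<bar>C $$ (i, j)\<bar>) * l1_norm (B *\<^sub>v z)"
proof -
  define b where "b = (\<Sum>i<n. \<Sum>j<n. \<bar>C $$ (i, j)\<bar>)"
  define w where "w = B *\<^sub>v z"
  have w: "w \<in> carrier_vec n" unfolding w_def using B z by simp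
  have "C *\<^sub>v w = (C * B) *\<^sub>v z" unfolding w_def using B C z by simp
  then have "z = C *\<^sub>v w" unfolding CB using z by simp
  then have "z $ i = (\<Sum>j<n. C $$ (i, j) * w $ j)"
    using i C w by (simp add: scalar_prod_def atLeast0LessThan)
  also have "\<bar>\<dots>\<bar> \<le> (\<Sum>j<n. \<bar>C $$ (i, j)\<bar> * \<bar>w $ j\<bar>)"
    by (rule order_trans[OF sum_abs]) (simp add: abs_mult)
  also have "\<dots> \<le> (\<Sum>j<n. b * \<bar>w $ j\<bar>)"
  proof (intro sum_mono mult_right_mono)
    fix j assume j: "j \<in> {..<n}"
    have "\<bar>C $$ (i, j)\<bar> \<le> (\<Sum>j<n. \<bar>C $$ (i, j)\<bar>)"
      using j by (intro member_le_sum) auto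
    also have "\<dots> \<le> b" unfolding b_def using i by (intro member_le_sum) (auto intro: sum_nonneg)
    finally show "\<bar>C $$ (i, j)\<bar> \<le> b" .
  qed simp
  also have "\<dots> = b * l1_norm w" using w unfolding l1_norm_def by (simp add: sum_distrib_left)
  finally show ?thesis unfolding b_def w_def .
qed

lemma l1_norm_nonneg: "l1_norm x \<ge> 0"
  unfolding l1_norm_def by (intro sum_nonneg) simp

text \<open>Minkowski up to a constant. The pigeonhole bound applies to the integer matrices floor
  (k B); rounding is harmless because the coefficients are bounded by the very norm M that is being
  estimated. Of the factor 4, one 2 leaves room for the determinant of the approximation, the other
  absorbs a rounding error of at most M / 2.\<close>

lemma short_vector_real_lattice:
  fixes B :: "real mat"
  assumes B: "B \<in> carrier_mat n n" and det: "det B \<noteq> 0" and n: "n \<ge> 1"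
  shows "\<exists>z\<in>carrier_vec n. z \<noteq> 0\<^sub>v n \<and>
    l1_norm (B *\<^sub>v map_vec real_of_int z) \<le> 4 * real n * \<bar>det B\<bar> powr (1 / real n)"
proof -
  obtain C where C: "C \<in> carrier_mat n n" "C * B = 1\<^sub>m n"
    using invertible_mat_if_det_nonzero[OF B det] by blast
  define s where "s = \<bar>det B\<bar> powr (1 / real n)"
  have s: "s > 0" unfolding s_def using det by simp
  have sn: "s ^ n = \<bar>det B\<bar>"
    unfolding s_def using det n by (simp add: powr_realpow[symmetric] powr_powr)
  define b where "b = (\<Sum>i<n. \<Sum>j<n. \<bar>C $$ (i, j)\<bar>)"
  have b0: "b \<ge> 0" unfolding b_def by (intro sum_nonneg) simp
  define A where "A k = mat n n (\<lambda>(i, j). \<lfloor>real k * B $$ (i, j)\<rfloor>)" for k :: nat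
  have A: "A k \<in> carrier_mat n n" for k unfolding A_def by simp
  define A' where "A' k = mat n n (\<lambda>(i, j). real_of_int \<lfloor>real k * B $$ (i, j)\<rfloor> / real k)" for k :: nat
  have A': "A' k \<in> carrier_mat n n" for k unfolding A'_def by simp
  have AA': "map_mat real_of_int (A k) = real k \<cdot>\<^sub>m A' k" if "k > 0" for k
    unfolding A_def A'_def using that by (intro eq_matI) auto
  have close: "\<bar>B $$ (i, j) - A' k $$ (i, j)\<bar> \<le> 1 / real k" if "i < n" "j < n" "k > 0" for i j k
  proof -
    have "\<bar>real k * B $$ (i, j) - real_of_int \<lfloor>real k * B $$ (i, j)\<rfloor>\<bar> \<le> 1" by linarith
    moreover have "real k * B $$ (i, j) - real_of_int \<lfloor>real k * B $$ (i, j)\<rfloor>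
        = real k * (B $$ (i, j) - A' k $$ (i, j))"
      using that unfolding A'_def by (simp add: algebra_simps)
    ultimately have "real k * \<bar>B $$ (i, j) - A' k $$ (i, j)\<bar> \<le> 1" by (simp add: abs_mult)
    then show ?thesis using that by (simp add: field_simps)
  qed
  have lim: "(\<lambda>k. A' k $$ (i, j)) \<longlonglongrightarrow> B $$ (i, j)" if ij: "i < n" "j < n" for i j
  proof -
    have "(\<lambda>k. \<bar>B $$ (i, j) - A' k $$ (i, j)\<bar>) \<longlonglongrightarrow> 0"
    proof (rule tendsto_sandwich[OF _ _ tendsto_const lim_1_over_n])
      show "\<forall>\<^sub>F k in sequentially. \<bar>B $$ (i, j) - A' k $$ (i, j)\<bar> \<le> 1 / real k"
        using eventually_gt_at_top[of 0] by eventually_elim (use close[OF ij] in auto)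
    qed simp
    then have "(\<lambda>k. B $$ (i, j) - (B $$ (i, j) - A' k $$ (i, j))) \<longlonglongrightarrow> B $$ (i, j) - 0"
      by (intro tendsto_diff tendsto_const) (simp add: tendsto_rabs_zero_iff)
    then show ?thesis by simp
  qed
  have lim_det: "(\<lambda>k. \<bar>det (A' k)\<bar>) \<longlonglongrightarrow> \<bar>det B\<bar>"
    by (intro tendsto_rabs tendsto_det[OF A' B lim])
  have "\<bar>det B\<bar> < 2 ^ n * \<bar>det B\<bar>" and "0 < \<bar>det B\<bar>"
    using det n by simp_all
  from order_tendstoD(2)[OF lim_det this(1)] order_tendstoD(1)[OF lim_det this(2)]
  have "\<forall>\<^sub>F k in sequentially. \<bar>det (A' k)\<bar> < 2 ^ n * \<bar>det B\<bar>"
    and "\<forall>\<^sub>F k in sequentially. 0 < \<bar>det (A' k)\<bar>" .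
  \<comment> \<open>Beyond this threshold b n^2 / k is at most 1/2.\<close>
  moreover have "\<forall>\<^sub>F k in sequentially. k > max 1 (nat \<lceil>2 * (b * n * n)\<rceil>)"
    by (rule eventually_gt_at_top)
  ultimately have "\<forall>\<^sub>F k in sequentially. \<bar>det (A' k)\<bar> < 2 ^ n * \<bar>det B\<bar> \<and> 0 < \<bar>det (A' k)\<bar> \<and>
      k > max 1 (nat \<lceil>2 * (b * n * n)\<rceil>)"
    by eventually_elim simp
  then obtain k where k: "\<bar>det (A' k)\<bar> < 2 ^ n * \<bar>det B\<bar>" "0 < \<bar>det (A' k)\<bar>"
      "k > max 1 (nat \<lceil>2 * (b * n * n)\<rceil>)"
    unfolding eventually_sequentially by blast
  then have k: "\<bar>det (A' k)\<bar> < 2 ^ n * \<bar>det B\<bar>" "0 < \<bar>det (A' k)\<bar>" "k > 0" "2 * (b * n * n) \<le> k"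
    by (auto simp: zless_nat_eq_int_zless intro: order_trans) linarith?
  define K where "K = nat \<lfloor>2 * s * real k\<rfloor>"
  have K: "real K \<le> 2 * s * real k" "2 * s * real k < real (K + 1)"
    unfolding K_def using s by (simp_all add: of_nat_nat) linarith
  have detA: "real_of_int (det (A k)) = real k ^ n * det (A' k)"
    unfolding of_int_hom.hom_det[symmetric] AA'[OF k(3)] using A'[of k] by simp
  have "real_of_int \<bar>det (A k)\<bar> = real k ^ n * \<bar>det (A' k)\<bar>"
    using detA by (simp add: abs_mult)
  also have "\<dots> < real k ^ n * (2 ^ n * s ^ n)"
    using k unfolding sn by (intro mult_strict_left_mono) auto
  also have "\<dots> = (2 * s * real k) ^ n" by (simp add: power_mult_distrib)
  also have "\<dots> \<le> real (K + 1) ^ n" using K s by (intro power_mono) auto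
  finally have "real_of_int \<bar>det (A k)\<bar> < real_of_int (int (K + 1) ^ n)" by simp
  then have big: "int (K + 1) ^ n > \<bar>det (A k)\<bar>" by linarith
  have "det (A k) \<noteq> 0" using detA k by auto
  from short_vector_int_lattice[OF A this big] obtain z where z: "z \<in> carrier_vec n" "z \<noteq> 0\<^sub>v n"
    and small: "\<And>i. i < n \<Longrightarrow> \<bar>(A k *\<^sub>v z) $ i\<bar> \<le> int K" by blast
  define y where "y = map_vec real_of_int z"
  have y: "y \<in> carrier_vec n" unfolding y_def using z by simp
  define M where "M = l1_norm (B *\<^sub>v y)"
  have yi: "\<bar>y $ i\<bar> \<le> b * M" if "i < n" for i
    unfolding b_def M_def by (rule l1_norm_le_inverse[OF B C y that])
  have "\<bar>(B *\<^sub>v y) $ i\<bar> \<le> 2 * s + b * n * M / k" if i: "i < n" for i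
  proof -
    have "(B *\<^sub>v y) $ i = (\<Sum>j<n. B $$ (i, j) * y $ j)"
      using i B y by (simp add: scalar_prod_def atLeast0LessThan)
    also have "\<dots> = (\<Sum>j<n. A' k $$ (i, j) * y $ j) + (\<Sum>j<n. (B $$ (i, j) - A' k $$ (i, j)) * y $ j)"
      by (simp add: sum.distrib[symmetric] algebra_simps)
    finally have "\<bar>(B *\<^sub>v y) $ i\<bar> \<le> \<bar>\<Sum>j<n. A' k $$ (i, j) * y $ j\<bar>
        + \<bar>\<Sum>j<n. (B $$ (i, j) - A' k $$ (i, j)) * y $ j\<bar>" by linarith
    moreover have "\<bar>\<Sum>j<n. A' k $$ (i, j) * y $ j\<bar> \<le> 2 * s"
    proof -
      have "real k * (\<Sum>j<n. A' k $$ (i, j) * y $ j) = real_of_int ((A k *\<^sub>v z) $ i)"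
        using i z k unfolding y_def A_def A'_def
        by (simp add: scalar_prod_def atLeast0LessThan sum_distrib_left)
      then have "real k * \<bar>\<Sum>j<n. A' k $$ (i, j) * y $ j\<bar> \<le> real K"
        using small[OF i] by (metis abs_mult abs_of_nat of_int_abs of_int_le_iff of_int_of_nat_eq)
      also have "\<dots> \<le> real k * (2 * s)" using K by (simp add: algebra_simps)
      finally show ?thesis using k by simp
    qed
    moreover have "\<bar>\<Sum>j<n. (B $$ (i, j) - A' k $$ (i, j)) * y $ j\<bar> \<le> (\<Sum>j<n. 1 / k * (b * M))"
      by (rule order_trans[OF sum_abs], intro sum_mono, unfold abs_mult, intro mult_mono)
         (use close[OF i] yi k in auto)
    ultimately show ?thesis by (simp add: mult_ac)
  qed
  then have "M \<le> (\<Sum>i<n. 2 * s + b * n * M / k)"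
    unfolding M_def l1_norm_def[of "B *\<^sub>v y"] using B y by (intro order_trans[OF eq_refl sum_mono]) auto
  also have "\<dots> = 2 * s * n + (b * n * n / k) * M" by (simp add: algebra_simps)
  also have "\<dots> \<le> 2 * s * n + (1 / 2) * M"
    using k l1_norm_nonneg unfolding M_def by (intro add_left_mono mult_right_mono) (auto simp: field_simps)
  finally have "M / 2 \<le> 2 * s * n" by simp
  then have "M \<le> 4 * real n * s" by (simp add: mult_ac)
  then show ?thesis using z unfolding M_def y_def s_def by blast
qed

section \<open>The least lattice constant\<close>

lemma finite_bounded_int_vecs:
  "finite {z \<in> carrier_vec n. \<forall>i<n. \<bar>z $ i\<bar> \<le> (K :: int)}"
proof (rule finite_subset)
  show "{z \<in> carrier_vec n. \<forall>i<n. \<bar>z $ i\<bar> \<le> K} \<subseteq> vec n ` (Pi\<^sub>E {..<n} (\<lambda>_. {-K..K}))"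
  proof
    fix z assume z: "z \<in> {z \<in> carrier_vec n. \<forall>i<n. \<bar>z $ i\<bar> \<le> K}"
    then have "z = vec n (restrict (\<lambda>i. z $ i) {..<n})" by auto
    moreover have "restrict (\<lambda>i. z $ i) {..<n} \<in> Pi\<^sub>E {..<n} (\<lambda>_. {-K..K})"
      using z by (auto simp: abs_le_iff minus_le_iff)
    ultimately show "z \<in> vec n ` (Pi\<^sub>E {..<n} (\<lambda>_. {-K..K}))" by (rule image_eqI)
  qed
qed (intro finite_imageI finite_PiE, auto)

text \<open>An infimum of norms is attained since only finitely many lattice vectors are bounded.\<close>

lemma lattice_min_attained:
  assumes L: "lattice_basis n B L" and d: "\<And>e. e > d \<Longrightarrow> \<exists>x\<in>L. x \<noteq> 0\<^sub>v n \<and> l1_norm x \<le> e"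
  shows "\<exists>x\<in>L. x \<noteq> 0\<^sub>v n \<and> l1_norm x \<le> d"
proof -
  have B: "B \<in> carrier_mat n n" using L unfolding lattice_basis_def by simp
  obtain C where C: "C \<in> carrier_mat n n" "C * B = 1\<^sub>m n"
    using invertible_mat_if_det_nonzero[OF B lattice_basis_det_nonzero[OF L]] by blast
  define b where "b = (\<Sum>i<n. \<Sum>j<n. \<bar>C $$ (i, j)\<bar>)"
  have b0: "b \<ge> 0" unfolding b_def by (intro sum_nonneg) simp
  define Z where "Z = {z \<in> carrier_vec n. \<forall>i<n. \<bar>z $ i\<bar> \<le> \<lfloor>b * (d + 1)\<rfloor>}"
  define X where "X = {x \<in> L. x \<noteq> 0\<^sub>v n \<and> l1_norm x \<le> d + 1}"
  have "X \<subseteq> (\<lambda>z. B *\<^sub>v map_vec real_of_int z) ` Z"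
  proof
    fix x assume x: "x \<in> X"
    then obtain z where z: "z \<in> carrier_vec n" "x = B *\<^sub>v map_vec real_of_int z"
      using L unfolding X_def lattice_basis_def by auto
    have "\<bar>z $ i\<bar> \<le> \<lfloor>b * (d + 1)\<rfloor>" if i: "i < n" for i
    proof -
      have "\<bar>map_vec real_of_int z $ i\<bar> \<le> b * l1_norm x"
        unfolding b_def z(2) using z(1) by (intro l1_norm_le_inverse[OF B C _ i]) simp
      also have "\<dots> \<le> b * (d + 1)" using b0 x unfolding X_def by (intro mult_left_mono) auto
      finally show ?thesis using i z(1) by (simp add: le_floor_iff)
    qed
    then show "x \<in> (\<lambda>z. B *\<^sub>v map_vec real_of_int z) ` Z" using z unfolding Z_def by auto
  qed
  then have fin: "finite X" unfolding Z_def by (rule finite_subset) (intro finite_imageI finite_bounded_int_vecs)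
  have "X \<noteq> {}" using d[of "d + 1"] unfolding X_def by auto
  then obtain x where x: "x \<in> X" and min: "\<And>y. y \<in> X \<Longrightarrow> l1_norm x \<le> l1_norm y"
    using ex_min_if_finite[of "l1_norm ` X"] fin by (metis (no_types, lifting) arg_min_if_finite(1) arg_min_least)
  have "l1_norm x \<le> d"
  proof (rule field_le_epsilon)
    fix e :: real assume e: "e > 0"
    obtain y where y: "y \<in> L" "y \<noteq> 0\<^sub>v n" "l1_norm y \<le> d + min e 1"
      using d[of "d + min e 1"] e by auto
    then have "y \<in> X" unfolding X_def by auto
    from min[OF this] y(3) show "l1_norm x \<le> d + e" by linarith
  qed
  then show ?thesis using x unfolding X_def by auto
qed

text \<open>The predicate under \<open>LEAST\<close> in \<open>l1_lattice_const\<close>, word for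
  word, so that unfolding matches the two.\<close>

definition admissible_l1_const :: "nat \<Rightarrow> real \<Rightarrow> bool" where
  "admissible_l1_const n d \<longleftrightarrow> d > 0 \<and> (\<forall>L. full_rank_lattice n L \<longrightarrow>
     (\<exists>x\<in>L. x \<noteq> 0\<^sub>v n \<and> l1_norm x \<le> d * lattice_covolume n L powr (1 / real n)))"

text \<open>Tested on the standard lattice: covolume 1, and nonzero vectors have norm at least 1.
  This keeps the infimum of the admissible constants positive.\<close>

lemma admissible_l1_const_ge_1:
  assumes "admissible_l1_const n d"
  shows "d \<ge> 1"
proof -
  let ?L = "{1\<^sub>m n *\<^sub>v map_vec real_of_int z | z. z \<in> carrier_vec n}"
  have "invertible_mat (1\<^sub>m n :: real mat)"
    using invertible_mat_if_det_nonzero[of "1\<^sub>m n :: real mat" n] by auto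
  then have L: "lattice_basis n (1\<^sub>m n) ?L" unfolding lattice_basis_def by simp
  then have "full_rank_lattice n ?L" unfolding full_rank_lattice_def by blast
  then obtain x where x: "x \<in> ?L" "x \<noteq> 0\<^sub>v n" "l1_norm x \<le> d"
    using assms unfolding admissible_l1_const_def lattice_covolume_eq[OF L]
    by (metis (no_types, lifting) abs_one det_one lattice_covolume_eq[OF L] mult.right_neutral powr_one_eq_one)
  then obtain z :: "int vec" where z: "z \<in> carrier_vec n" "x = map_vec real_of_int z" by auto
  have "z \<noteq> 0\<^sub>v n" using x(2) z(2) by auto
  then obtain i where i: "i < n" "z $ i \<noteq> 0" using z(1) by (metis carrier_vecD eq_vecI index_zero_vec)
  then have "\<bar>z $ i\<bar> \<ge> 1" by linarith
  then have "\<bar>x $ i\<bar> \<ge> 1" using i z by (simp flip: of_int_abs)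
  also have "\<bar>x $ i\<bar> \<le> l1_norm x" unfolding l1_norm_def using i z by (intro member_le_sum) auto
  finally show ?thesis using x(3) by simp
qed

text \<open>\<open>LEAST\<close> on the reals carries information only once a minimum exists. The
  constant 4 n is admissible, so the infimum exists; it is admissible because each single lattice
  attains its shortest norm.\<close>

lemma l1_lattice_const_admissible:
  assumes n: "n \<ge> 1"
  shows "admissible_l1_const n (l1_lattice_const n)"
proof -
  define S where "S = Collect (admissible_l1_const n)"
  have "4 * real n \<in> S"
    unfolding S_def admissible_l1_const_def mem_Collect_eq
  proof (intro conjI allI impI)
    fix L assume "full_rank_lattice n L"
    then obtain B where B: "lattice_basis n B L" unfolding full_rank_lattice_def by blast
    then have B': "B \<in> carrier_mat n n" unfolding lattice_basis_def by simp
    note det = lattice_basis_det_nonzero[OF B]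
    obtain z where z: "z \<in> carrier_vec n" "z \<noteq> 0\<^sub>v n"
      "l1_norm (B *\<^sub>v map_vec real_of_int z) \<le> 4 * real n * \<bar>det B\<bar> powr (1 / real n)"
      using short_vector_real_lattice[OF B' det n] by blast
    have "B *\<^sub>v map_vec real_of_int z \<noteq> 0\<^sub>v n"
    proof
      assume 0: "B *\<^sub>v map_vec real_of_int z = 0\<^sub>v n"
      obtain C where C: "C \<in> carrier_mat n n" "C * B = 1\<^sub>m n"
        using invertible_mat_if_det_nonzero[OF B' det] by blast
      have "map_vec real_of_int z $ i = 0" if "i < n" for i
        using l1_norm_le_inverse[OF B' C _ that, of "map_vec real_of_int z"] z(1)
        unfolding 0 by (simp add: l1_norm_def)
      then show False using z(1,2) by (auto simp: vec_eq_iff)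
    qed
    then show "\<exists>x\<in>L. x \<noteq> 0\<^sub>v n \<and> l1_norm x \<le> 4 * real n * lattice_covolume n L powr (1 / real n)"
      using z B unfolding lattice_covolume_eq[OF B] lattice_basis_def by blast
  qed (use n in auto)
  then have ne: "S \<noteq> {}" by blast
  have ge1: "1 \<le> d" if "d \<in> S" for d using admissible_l1_const_ge_1 that unfolding S_def by blast
  have bdd: "bdd_below S" by (rule bdd_belowI[OF ge1])
  have "admissible_l1_const n (Inf S)"
    unfolding admissible_l1_const_def
  proof (intro conjI allI impI)
    have "1 \<le> Inf S" using cInf_greatest[OF ne ge1] by simp
    then show "Inf S > 0" by simp
    fix L assume L: "full_rank_lattice n L"
    then obtain B where B: "lattice_basis n B L" unfolding full_rank_lattice_def by blast
    define v where "v = lattice_covolume n L powr (1 / real n)"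
    have v: "v > 0" unfolding v_def lattice_covolume_eq[OF B] using lattice_basis_det_nonzero[OF B] by simp
    have "\<exists>x\<in>L. x \<noteq> 0\<^sub>v n \<and> l1_norm x \<le> Inf S * v"
    proof (rule lattice_min_attained[OF B])
      fix e assume "e > Inf S * v"
      then have "Inf S < e / v" using v by (simp add: field_simps)
      then obtain d where d: "d \<in> S" "d < e / v" using cInf_lessD[OF ne] by blast
      then obtain x where x: "x \<in> L" "x \<noteq> 0\<^sub>v n" "l1_norm x \<le> d * v"
        using L unfolding S_def admissible_l1_const_def v_def by auto
      moreover have "d * v \<le> e" using d(2) v by (simp add: field_simps)
      ultimately show "\<exists>x\<in>L. x \<noteq> 0\<^sub>v n \<and> l1_norm x \<le> e" by fastforce
    qed
    then show "\<exists>x\<in>L. x \<noteq> 0\<^sub>v n \<and> l1_norm x \<le> Inf S * lattice_covolume n L powr (1 / real n)"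
      unfolding v_def .
  qed
  then have "Inf S \<in> S" unfolding S_def by simp
  then have "(LEAST d. admissible_l1_const n d) = Inf S"
    using cInf_lower[OF _ bdd] by (intro Least_equality) (auto simp: S_def)
  then have "l1_lattice_const n = Inf S"
    unfolding l1_lattice_const_def admissible_l1_const_def .
  then show ?thesis using \<open>Inf S \<in> S\<close> unfolding S_def by simp
qed

section \<open>A lower bound for the lattice constant\<close>

definition l1_int_ball :: "nat \<Rightarrow> (nat \<Rightarrow> int) set" where
  "l1_int_ball n = {x. (\<forall>i\<ge>n. x i = 0) \<and> (\<Sum>i<n. \<bar>x i\<bar>) \<le> int n}"

lemma sum_half_powers_le_3: "(\<Sum>k\<in>{- int n..int n}. (1 / 2 :: real) ^ nat \<bar>k\<bar>) = 3 - 2 * (1 / 2) ^ n"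
proof (induction n)
  case (Suc n)
  have "{- int (Suc n)..int (Suc n)} = insert (int n + 1) (insert (- (int n + 1)) {- int n..int n})"
    by auto
  moreover have "nat \<bar>int n + 1\<bar> = Suc n" "nat \<bar>- (int n + 1)\<bar> = Suc n" by linarith+
  ultimately have "(\<Sum>k\<in>{- int (Suc n)..int (Suc n)}. (1 / 2 :: real) ^ nat \<bar>k\<bar>)
      = (1 / 2) ^ Suc n + ((1 / 2) ^ Suc n + (\<Sum>k\<in>{- int n..int n}. (1 / 2) ^ nat \<bar>k\<bar>))"
    by (simp only:) (subst sum.insert; simp)+
  then show ?case using Suc.IH by simp
qed simp

text \<open>Give x the weight 2^-|x| in the l1-norm. Every point of the ball weighs at least 2^-n,
  while the total weight of the enclosing cube factors into n sums, each at most 3; hence at most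
  2^n 3^n points.\<close>

lemma card_l1_int_ball: "finite (l1_int_ball n)" "card (l1_int_ball n) \<le> 6 ^ n"
proof -
  define P where "P = Pi\<^sub>E {..<n} (\<lambda>_. {- int n..int n})"
  define r where "r x = restrict x {..<n}" for x :: "nat \<Rightarrow> int"
  have finP: "finite P" unfolding P_def by (intro finite_PiE) auto
  have inj: "inj_on r (l1_int_ball n)"
  proof (rule inj_onI, rule ext)
    fix x y i assume xy: "x \<in> l1_int_ball n" "y \<in> l1_int_ball n" "r x = r y"
    show "x i = y i"
    proof (cases "i < n")
      case True
      then show ?thesis using fun_cong[OF xy(3), of i] unfolding r_def by simp
    qed (use xy in \<open>auto simp: l1_int_ball_def\<close>)
  qed
  have sub: "r ` l1_int_ball n \<subseteq> P"
  proof
    fix y assume "y \<in> r ` l1_int_ball n"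
    then obtain x where x: "x \<in> l1_int_ball n" "y = r x" by blast
    have "\<bar>x i\<bar> \<le> int n" if "i < n" for i
    proof -
      have "\<bar>x i\<bar> \<le> (\<Sum>i<n. \<bar>x i\<bar>)" using that by (intro member_le_sum) auto
      then show ?thesis using x(1) unfolding l1_int_ball_def by simp
    qed
    then show "y \<in> P" unfolding x(2) r_def P_def by (auto simp: abs_le_iff minus_le_iff)
  qed
  show fin: "finite (l1_int_ball n)" using finite_imageD[OF finite_subset[OF sub finP] inj] .
  have "real (card (l1_int_ball n)) * (1 / 2) ^ n = (\<Sum>x\<in>l1_int_ball n. (1 / 2) ^ n)" by simp
  also have "\<dots> \<le> (\<Sum>x\<in>l1_int_ball n. \<Prod>i<n. (1 / 2) ^ nat \<bar>r x i\<bar>)"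
  proof (rule sum_mono)
    fix x assume "x \<in> l1_int_ball n"
    then have "int (\<Sum>i<n. nat \<bar>x i\<bar>) \<le> int n" unfolding l1_int_ball_def by simp
    then have "(\<Sum>i<n. nat \<bar>x i\<bar>) \<le> n" by (simp only: of_nat_le_iff)
    then have "(1 / 2 :: real) ^ n \<le> (1 / 2) ^ (\<Sum>i<n. nat \<bar>x i\<bar>)" by (intro power_decreasing) auto
    also have "\<dots> = (\<Prod>i<n. (1 / 2) ^ nat \<bar>r x i\<bar>)" unfolding r_def by (simp add: power_sum)
    finally show "(1 / 2 :: real) ^ n \<le> (\<Prod>i<n. (1 / 2) ^ nat \<bar>r x i\<bar>)" .
  qed
  also have "\<dots> = (\<Sum>y\<in>r ` l1_int_ball n. \<Prod>i<n. (1 / 2) ^ nat \<bar>y i\<bar>)"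
    by (simp add: sum.reindex[OF inj])
  also have "\<dots> \<le> (\<Sum>y\<in>P. \<Prod>i<n. (1 / 2) ^ nat \<bar>y i\<bar>)"
    by (intro sum_mono2 finP sub) (auto intro: prod_nonneg)
  also have "\<dots> = (\<Prod>i<n. \<Sum>k\<in>{- int n..int n}. (1 / 2) ^ nat \<bar>k\<bar>)"
    unfolding P_def by (subst prod_sum_PiE) auto
  also have "\<dots> \<le> (\<Prod>i<n. 3)"
    unfolding sum_half_powers_le_3 by (intro prod_mono) (auto simp: power_le_one intro: order_trans[of _ "2 * 1"])
  finally have "real (card (l1_int_ball n)) \<le> 6 ^ n"
    by (simp add: power_divide field_simps flip: power_mult_distrib)
  then show "card (l1_int_ball n) \<le> 6 ^ n" by (simp flip: of_nat_power)
qed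

text \<open>The coefficients are chosen one by one, \<open>a k\<close> taking care of the vectors
  whose last nonzero coordinate is k. Each of them excludes at most one residue for
  \<open>a k\<close>, and p exceeds the number of points in the ball.\<close>

lemma linear_form_avoiding_ball:
  assumes p: "prime (p :: nat)" and big: "6 ^ n < p"
  shows "\<exists>a. \<forall>x\<in>l1_int_ball n. x \<noteq> (\<lambda>i. 0) \<longrightarrow> \<not> int p dvd (\<Sum>i<n. a i * x i)"
proof -
  have "\<exists>a. \<forall>x\<in>l1_int_ball n. x \<noteq> (\<lambda>i. 0) \<longrightarrow> (\<forall>i\<ge>k. x i = 0) \<longrightarrow> \<not> int p dvd (\<Sum>i<k. a i * x i)"
    if "k \<le> n" for k
    using that
  proof (induction k)
    case 0
    then show ?case by (auto simp: fun_eq_iff)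
  next
    case (Suc k)
    then have k: "k < n" by simp
    from Suc obtain a where a: "\<And>x. x \<in> l1_int_ball n \<Longrightarrow> x \<noteq> (\<lambda>i. 0) \<Longrightarrow> \<forall>i\<ge>k. x i = 0 \<Longrightarrow>
      \<not> int p dvd (\<Sum>i<k. a i * x i)" by auto
    have "\<exists>c\<in>{0..<int p}. \<forall>x\<in>l1_int_ball n. x k \<noteq> 0 \<longrightarrow> \<not> int p dvd (\<Sum>i<k. a i * x i) + c * x k"
    proof (rule ccontr)
      assume "\<not> ?thesis"
      then have "\<forall>c\<in>{0..<int p}. \<exists>x. x \<in> l1_int_ball n \<and> x k \<noteq> 0 \<and>
        int p dvd (\<Sum>i<k. a i * x i) + c * x k" by blast
      from bchoice[OF this] obtain h where h: "\<forall>c\<in>{0..<int p}. h c \<in> l1_int_ball n \<and> h c k \<noteq> 0 \<and>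
        int p dvd (\<Sum>i<k. a i * h c i) + c * h c k" ..
      \<comment> \<open>If one vector served two residues c and d, then p would divide (c - d) times
        its k-th entry, yet both factors are nonzero and smaller than p in absolute value.\<close>
      have "inj_on h {0..<int p}"
      proof (rule inj_onI, rule ccontr)
        fix c d assume c: "c \<in> {0..<int p}" and d: "d \<in> {0..<int p}" and eq: "h c = h d" and ne: "c \<noteq> d"
        have "int p dvd ((\<Sum>i<k. a i * h c i) + c * h c k) - ((\<Sum>i<k. a i * h c i) + d * h c k)"
          using bspec[OF h c] bspec[OF h d, folded eq] by (intro dvd_diff) simp_all
        then have "int p dvd (c - d) * h c k" by (simp add: algebra_simps)
        then have "int p dvd c - d \<or> int p dvd h c k" using p by (simp add: prime_dvd_mult_iff)
        moreover have "\<bar>c - d\<bar> < int p" using c d by auto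
        moreover have "\<bar>h c k\<bar> < int p"
        proof -
          have "\<bar>h c k\<bar> \<le> (\<Sum>i<n. \<bar>h c i\<bar>)" using k by (intro member_le_sum) auto
          also have "\<dots> \<le> int n" using h c unfolding l1_int_ball_def by auto
          also have "n < (6 :: nat) ^ n" by (rule order_less_le_trans[OF less_exp power_mono]) auto
          then have "int n < int p" using big by simp
          finally show ?thesis .
        qed
        ultimately show False using dvd_imp_le_int[of "c - d" "int p"] dvd_imp_le_int[of "h c k" "int p"] ne h c by auto
      qed
      moreover have "h ` {0..<int p} \<subseteq> l1_int_ball n" using h by auto
      ultimately have "card {0..<int p} \<le> card (l1_int_ball n)"
        using card_l1_int_ball(1) by (metis card_inj_on_le)
      then show False using card_l1_int_ball(2)[of n] big by simp
    qed
    then obtain c where c: "\<forall>x\<in>l1_int_ball n. x k \<noteq> 0 \<longrightarrow> \<not> int p dvd (\<Sum>i<k. a i * x i) + c * x k" by blast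
    define a' where "a' = a(k := c)"
    have sum: "(\<Sum>i<Suc k. a' i * x i) = (\<Sum>i<k. a i * x i) + c * x k" for x
      unfolding a'_def by simp
    have "\<not> int p dvd (\<Sum>i<Suc k. a' i * x i)"
      if x: "x \<in> l1_int_ball n" "x \<noteq> (\<lambda>i. 0)" "\<forall>i\<ge>Suc k. x i = 0" for x
    proof (cases "x k = 0")
      case True
      then have "\<forall>i\<ge>k. x i = 0" using x(3) by (metis le_antisym not_less_eq_eq)
      from a[OF x(1,2) this] show ?thesis unfolding sum using True by simp
    qed (use c x(1) sum in auto)
    then show ?case by blast
  qed
  from this[of n] show ?thesis unfolding l1_int_ball_def by auto
qed

text \<open>The vectors v with p dividing a . v form a lattice of covolume at most p, one label per
  residue, while all its nonzero vectors have norm above n.\<close>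

lemma admissible_l1_const_prime_bound:
  assumes d: "admissible_l1_const n d" and n: "n \<ge> 1" and p: "prime p" and big: "6 ^ n < p"
  shows "real n < d * real p powr (1 / real n)"
proof -
  obtain a where a: "\<forall>x\<in>l1_int_ball n. x \<noteq> (\<lambda>i. 0) \<longrightarrow> \<not> int p dvd (\<Sum>i<n. a i * x i)"
    using linear_form_avoiding_ball[OF p big] by blast
  define \<Lambda> where "\<Lambda> = {x. (\<forall>i\<ge>n. x i = 0) \<and> int p dvd (\<Sum>i<n. a i * x i)}"
  define f where "f x = (\<Sum>i<n. a i * x i) mod int p" for x
  have lat: "int_lattice n \<Lambda>"
    unfolding int_lattice_def \<Lambda>_def by (auto simp: right_diff_distrib sum_subtractf)
  define L where "L = (\<lambda>v. 1\<^sub>m n *\<^sub>v vec n (\<lambda>i. real_of_int (v i))) ` \<Lambda>"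
  have fD: "\<forall>u\<in>nonneg_vecs n. f u \<in> {0..<int p}"
    unfolding f_def using prime_gt_0_nat[OF p] by simp
  have finj: "\<forall>u\<in>nonneg_vecs n. \<forall>v\<in>nonneg_vecs n. f u = f v \<longrightarrow> (\<lambda>i. u i - v i) \<in> \<Lambda>"
    unfolding \<Lambda>_def f_def nonneg_vecs_def
    by (auto simp: right_diff_distrib sum_subtractf mod_eq_dvd_iff)
  have det1: "det (1\<^sub>m n :: real mat) \<noteq> 0" by simp
  note kl = kernel_lattice[OF one_carrier_mat det1 lat finite_atLeastLessThan_int fD finj, folded L_def]
  have full: "full_rank_lattice n L" and cov: "lattice_covolume n L \<le> p" "lattice_covolume n L > 0"
    using kl by auto
  then obtain x where x: "x \<in> L" "x \<noteq> 0\<^sub>v n" "l1_norm x \<le> d * lattice_covolume n L powr (1 / real n)"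
    using d unfolding admissible_l1_const_def by blast
  then obtain v where v: "v \<in> \<Lambda>" "x = vec n (\<lambda>i. real_of_int (v i))" unfolding L_def by auto
  have "v \<noteq> (\<lambda>i. 0)" using x(2) v(2) by auto
  then have "v \<notin> l1_int_ball n" using a v(1) unfolding \<Lambda>_def by auto
  then have "int n < (\<Sum>i<n. \<bar>v i\<bar>)" using v(1) unfolding l1_int_ball_def \<Lambda>_def by auto
  then have "real n < real_of_int (\<Sum>i<n. \<bar>v i\<bar>)" by linarith
  also have "\<dots> = l1_norm x" unfolding v(2) l1_norm_def by simp
  also have "\<dots> \<le> d * lattice_covolume n L powr (1 / real n)" by (rule x(3))
  also have "\<dots> \<le> d * real p powr (1 / real n)"
    using d cov unfolding admissible_l1_const_def by (intro mult_left_mono powr_mono2) auto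
  finally show ?thesis .
qed

text \<open>The prime comes first: n is then determined by 6^n < p \<le> 6^(n+1), and unboundedly
  large primes give unboundedly large n.\<close>

lemma l1_lattice_const_lower_bound:
  "\<exists>n\<ge>k. real n < l1_lattice_const n * (6 * 6 powr (1 / real n))"
proof -
  obtain p :: nat where p: "prime p" "p > 6 ^ (k + 1)" using bigger_prime by blast
  define n where "n = (LEAST n. p \<le> 6 ^ (n + 1))"
  have "p < 2 ^ p" "(2 :: nat) ^ p \<le> 6 ^ p" "(6 :: nat) ^ p \<le> 6 ^ (p + 1)"
    by (rule less_exp) (simp_all add: power_mono)
  then have "p \<le> 6 ^ (p + 1)" by linarith
  then have n: "p \<le> 6 ^ (n + 1)" unfolding n_def by (rule LeastI)
  have "k + 1 \<le> n"
  proof (rule ccontr)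
    assume "\<not> ?thesis"
    then have "(6 :: nat) ^ (n + 1) \<le> 6 ^ (k + 1)" by (intro power_increasing) auto
    with n p(2) show False by linarith
  qed
  have "\<not> p \<le> 6 ^ ((n - 1) + 1)"
    unfolding n_def by (rule not_less_Least) (use \<open>k + 1 \<le> n\<close> in \<open>simp add: n_def\<close>)
  then have big: "6 ^ n < p" using \<open>k + 1 \<le> n\<close> by simp
  have n1: "n \<ge> 1" using \<open>k + 1 \<le> n\<close> by simp
  note adm = l1_lattice_const_admissible[OF n1]
  have "real n < l1_lattice_const n * real p powr (1 / real n)"
    by (rule admissible_l1_const_prime_bound[OF adm n1 p(1) big])
  also have "\<dots> \<le> l1_lattice_const n * (6 ^ (n + 1)) powr (1 / real n)"
  proof (intro mult_left_mono powr_mono2)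
    have "real p \<le> real (6 ^ (n + 1))" using n by (rule of_nat_mono)
    then show "real p \<le> 6 ^ (n + 1)" by simp
  qed (use adm in \<open>auto simp: admissible_l1_const_def\<close>)
  also have "(6 ^ (n + 1) :: real) powr (1 / real n) = 6 * 6 powr (1 / real n)"
  proof -
    have "(6 ^ (n + 1) :: real) powr (1 / real n) = 6 powr (real (n + 1) * (1 / real n))"
      by (simp only: powr_powr powr_realpow[symmetric] zero_less_numeral)
    also have "real (n + 1) * (1 / real n) = 1 + 1 / real n" using n1 by (simp add: field_simps)
    finally show ?thesis by (simp add: powr_add)
  qed
  finally show ?thesis using \<open>k + 1 \<le> n\<close> by (intro exI[of _ n]) auto
qed

lemma density_le_6:
  fixes \<delta> C :: real
  assumes \<delta>: "\<delta> > 0"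
    and ev: "\<forall>\<^sub>F n in sequentially. l1_lattice_const n \<le> real n / \<delta> + C * ln (real n)"
  shows "\<delta> \<le> 6"
proof (rule ccontr)
  assume "\<not> \<delta> \<le> 6"
  then have "6 / \<delta> < 1" using \<delta> by simp
  have "(\<lambda>n. (1 / \<delta> + C * (ln (real n) / real n)) * (6 * 6 powr (1 / real n))) \<longlonglongrightarrow> (1 / \<delta> + C * 0) * (6 * 1)"
    by (intro tendsto_mult tendsto_add tendsto_const) real_asymp+
  then have "\<forall>\<^sub>F n in sequentially. (1 / \<delta> + C * (ln (real n) / real n)) * (6 * 6 powr (1 / real n)) < 1"
    by (rule order_tendstoD) (use \<open>6 / \<delta> < 1\<close> in simp)
  with ev have "\<forall>\<^sub>F n in sequentially. l1_lattice_const n * (6 * 6 powr (1 / real n)) < n"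
    using eventually_gt_at_top[of 0]
  proof eventually_elim
    case (elim n)
    have "l1_lattice_const n * (6 * 6 powr (1 / real n)) \<le> (real n / \<delta> + C * ln (real n)) * (6 * 6 powr (1 / real n))"
      using elim(1) by (intro mult_right_mono) auto
    also have "\<dots> = real n * ((1 / \<delta> + C * (ln (real n) / real n)) * (6 * 6 powr (1 / real n)))"
      using elim(3) by (simp add: field_simps)
    also have "\<dots> < real n * 1" using elim by (intro mult_strict_left_mono) auto
    finally show ?case by simp
  qed
  then obtain k where k: "\<And>n. n \<ge> k \<Longrightarrow> l1_lattice_const n * (6 * 6 powr (1 / real n)) < n"
    unfolding eventually_sequentially by blast
  obtain n where "n \<ge> k" "real n < l1_lattice_const n * (6 * 6 powr (1 / real n))"
    using l1_lattice_const_lower_bound by blast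
  then show False using k[of n] by simp
qed

section \<open>Mertens' estimate and the distribution of primes\<close>

lemma ln_fact_ge: "n \<ge> 1 \<Longrightarrow> ln (fact n) \<ge> real n * ln (real n) - real n"
proof (induction n rule: nat_induct_at_least)
  case (Suc n)
  have "ln (real (Suc n)) - ln (real n) \<le> (real (Suc n) - real n) / real n"
    using Suc.hyps by (intro ln_diff_le) auto
  then have "real n * (ln (real (Suc n)) - ln (real n)) \<le> 1"
    using Suc.hyps by (simp add: field_simps)
  moreover have "ln (fact (Suc n) :: real) = ln (real (Suc n)) + ln (fact n)"
    unfolding fact_Suc by (subst ln_mult) auto
  ultimately show ?case using Suc.IH by (simp add: algebra_simps)
qed simp

text \<open>Chebyshev's identity: ln k is the sum of \<open>mangoldt d\<close> over d dividing k,
  and after exchanging sums each d has at most N / d multiples.\<close>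

lemma ln_fact_le_mangoldt_sum:
  "ln (fact N) \<le> real N * (\<Sum>d = 1..N. mangoldt d / real d)"
proof -
  have "ln (fact N :: real) = (\<Sum>k = 1..N. ln (real k))"
    unfolding fact_prod of_nat_prod by (subst ln_prod) auto
  also have "\<dots> = (\<Sum>k = 1..N. \<Sum>d\<in>{d \<in> {1..N}. d dvd k}. mangoldt d)"
  proof (rule sum.cong[OF refl])
    fix k assume k: "k \<in> {1..N}"
    then have "{d \<in> {1..N}. d dvd k} = {d. d dvd k}"
      by (auto dest: dvd_imp_le intro: Suc_leI dvd_pos_nat)
    then show "ln (real k) = (\<Sum>d\<in>{d \<in> {1..N}. d dvd k}. mangoldt d)"
      using mangoldt_sum[of k, where ?'a = real] k by simp
  qed
  also have "\<dots> = (\<Sum>d = 1..N. \<Sum>k\<in>{k \<in> {1..N}. d dvd k}. mangoldt d)"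
    by (rule sum.swap_restrict) auto
  also have "\<dots> \<le> (\<Sum>d = 1..N. real N * (mangoldt d / real d))"
  proof (rule sum_mono)
    fix d assume d: "d \<in> {1..N}"
    have "{k \<in> {1..N}. d dvd k} \<subseteq> (\<lambda>j. d * j) ` {1..N div d}"
    proof
      fix k assume k: "k \<in> {k \<in> {1..N}. d dvd k}"
      then obtain j where j: "k = d * j" by auto
      then have "j \<ge> 1" "j \<le> N div d" using k d by (auto simp: less_eq_div_iff_mult_less_eq mult.commute intro: Suc_leI)
      then show "k \<in> (\<lambda>j. d * j) ` {1..N div d}" using j by auto
    qed
    then have "card {k \<in> {1..N}. d dvd k} \<le> card {1..N div d}"
      by (meson card_image_le card_mono finite_atLeastAtMost finite_imageI order_trans)
    then have "real (card {k \<in> {1..N}. d dvd k}) \<le> real (N div d)" by simp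
    also have "\<dots> \<le> real N / real d" by (rule of_nat_div_le_of_nat)
    finally have "real (card {k \<in> {1..N}. d dvd k}) * mangoldt d \<le> real N / real d * mangoldt d"
      by (intro mult_right_mono mangoldt_nonneg)
    then show "(\<Sum>k\<in>{k \<in> {1..N}. d dvd k}. mangoldt d) \<le> real N * (mangoldt d / real d)" by simp
  qed
  finally show ?thesis by (simp add: sum_distrib_left)
qed

text \<open>The powers of each p form a geometric series with sum at most 1 / (p - 1). A prime power
  up to N has base and exponent at most N, so a rectangle of pairs covers them all; the surplus
  terms are nonnegative.\<close>

lemma mangoldt_sum_le_primes:
  "(\<Sum>d = 1..N. mangoldt d / real d) \<le> (\<Sum>p | prime p \<and> p \<le> N. ln (real p) / (real p - 1))"
proof -
  define P where "P = {p. prime p \<and> p \<le> N}"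
  have finP: "finite P" unfolding P_def by (rule finite_subset[of _ "{..N}"]) auto
  define g where "g d = (mangoldt d / real d :: real)" for d
  have "(\<Sum>d = 1..N. g d) = (\<Sum>d\<in>{d \<in> {1..N}. primepow d}. g d)"
    by (rule sum.mono_neutral_right) (auto simp: g_def mangoldt_def)
  also have "\<dots> \<le> (\<Sum>d\<in>(\<lambda>(p, k). p ^ k) ` (P \<times> {1..N}). g d)"
  proof (rule sum_mono2)
    show "{d \<in> {1..N}. primepow d} \<subseteq> (\<lambda>(p, k). p ^ k) ` (P \<times> {1..N})"
    proof
      fix d assume d: "d \<in> {d \<in> {1..N}. primepow d}"
      then obtain p k where pk: "prime p" "k > 0" "d = p ^ k" unfolding primepow_def by auto
      have "p \<le> p ^ k" using prime_ge_1_nat[OF pk(1)] pk(2) by (rule self_le_power)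
      moreover have "k \<le> p ^ k"
        using order.strict_trans2[OF less_exp power_mono[OF prime_ge_2_nat[OF pk(1)]]] by (intro less_imp_le) simp
      ultimately have "(p, k) \<in> P \<times> {1..N}" using d pk unfolding P_def by auto
      then show "d \<in> (\<lambda>(p, k). p ^ k) ` (P \<times> {1..N})" using pk(3) by force
    qed
  qed (use finP in \<open>auto simp: g_def mangoldt_nonneg\<close>)
  also have "\<dots> \<le> (\<Sum>(p, k)\<in>P \<times> {1..N}. g (p ^ k))"
    using sum_image_le[of "P \<times> {1..N}" g "\<lambda>(p, k). p ^ k"] finP
    by (simp add: g_def mangoldt_nonneg case_prod_unfold comp_def)
  also have "\<dots> = (\<Sum>p\<in>P. \<Sum>k = 1..N. g (p ^ k))" by (simp add: sum.cartesian_product)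
  also have "\<dots> \<le> (\<Sum>p\<in>P. ln (real p) / (real p - 1))"
  proof (rule sum_mono)
    fix p assume "p \<in> P"
    then have p: "prime p" unfolding P_def by simp
    have p2: "real p \<ge> 2" using prime_ge_2_nat[OF p] by simp
    have "(\<Sum>k = 1..N. (1 / real p) ^ k) = (1 / real p) * (\<Sum>k<N. (1 / real p) ^ k)"
      by (simp add: sum_distrib_left sum.atLeast1_atMost_eq)
    also have "\<dots> = (1 / real p) * ((1 - (1 / real p) ^ N) / (1 - 1 / real p))"
      using p2 by (subst sum_gp_strict) auto
    also have "\<dots> \<le> (1 / real p) * (1 / (1 - 1 / real p))"
      using p2 by (intro mult_left_mono divide_right_mono) auto
    also have "\<dots> = 1 / (real p - 1)" using p2 by (simp add: field_simps)
    finally have "ln (real p) * (\<Sum>k = 1..N. (1 / real p) ^ k) \<le> ln (real p) * (1 / (real p - 1))"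
      using p2 by (intro mult_left_mono) auto
    moreover have "(\<Sum>k = 1..N. g (p ^ k)) = ln (real p) * (\<Sum>k = 1..N. (1 / real p) ^ k)"
      unfolding sum_distrib_left by (intro sum.cong refl) (simp add: g_def p power_divide)
    ultimately show "(\<Sum>k = 1..N. g (p ^ k)) \<le> ln (real p) / (real p - 1)" by simp
  qed
  finally show ?thesis unfolding g_def P_def .
qed

text \<open>Telescoping: the term at k is at most (ln k + 2) / (k - 1) - (ln (k + 1) + 2) / k. The
  bound is 0 at N = 1.\<close>

lemma sum_ln_over_pronic_le:
  "N \<ge> 1 \<Longrightarrow> (\<Sum>k = 2..N. ln (real k) / (real k * (real k - 1))) \<le> ln 2 + 2 - (ln (real N + 1) + 2) / real N"
proof (induction N rule: nat_induct_at_least)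
  case (Suc n)
  define x where "x = real n"
  have x: "x \<ge> 1" using Suc.hyps unfolding x_def by simp
  have "ln (x + 2) - ln (x + 1) \<le> ((x + 2) - (x + 1)) / (x + 1)"
    using x by (intro ln_diff_le) auto
  also have "\<dots> = 1 / (x + 1)" by simp
  finally have "x * (ln (x + 2) - ln (x + 1)) \<le> x * (1 / (x + 1))" using x by (intro mult_left_mono) auto
  also have "\<dots> \<le> 2" using x by (simp add: field_simps)
  finally have "ln (x + 1) \<le> (x + 1) * (ln (x + 1) + 2) - x * (ln (x + 2) + 2)" by (simp add: algebra_simps)
  then have "ln (x + 1) / ((x + 1) * x) \<le> ((x + 1) * (ln (x + 1) + 2) - x * (ln (x + 2) + 2)) / ((x + 1) * x)"
    using x by (intro divide_right_mono) auto
  also have "\<dots> = (ln (x + 1) + 2) / x - (ln (x + 2) + 2) / (x + 1)"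
    using x by (simp add: field_simps)
  finally have "ln (x + 1) / ((x + 1) * x) \<le> (ln (x + 1) + 2) / x - (ln (x + 2) + 2) / (x + 1)" .
  moreover have "(\<Sum>k = 2..Suc n. ln (real k) / (real k * (real k - 1)))
      = (\<Sum>k = 2..n. ln (real k) / (real k * (real k - 1))) + ln (x + 1) / ((x + 1) * x)"
    using Suc.hyps unfolding x_def by (simp add: add.commute)
  ultimately show ?case using Suc.IH unfolding x_def by (simp add: add.commute add.left_commute)
qed simp

definition odd_primes_upto :: "real \<Rightarrow> nat set" where
  "odd_primes_upto x = {p. prime p \<and> p \<noteq> 2 \<and> real p \<le> x}"

lemma finite_odd_primes_upto [simp]: "finite (odd_primes_upto x)"
proof (rule finite_subset)
  show "odd_primes_upto x \<subseteq> {..nat \<lfloor>x\<rfloor>}"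
    unfolding odd_primes_upto_def by (auto simp: le_nat_iff le_floor_iff)
qed simp

lemma odd_primes_upto_ge_3: "p \<in> odd_primes_upto x \<Longrightarrow> p \<ge> 3"
  using prime_ge_2_nat[of p] unfolding odd_primes_upto_def by force

text \<open>The constant is 5 = 1 + 3 + 1: Stirling's bound, the higher prime powers, and the prime
  2.\<close>

lemma mertens_lower_bound:
  assumes N: "N \<ge> 1"
  shows "(\<Sum>p\<in>odd_primes_upto (real N). ln (real p) / real p) \<ge> ln (real N) - 5"
proof -
  define P where "P = {p. prime p \<and> p \<le> N}"
  have finP: "finite P" unfolding P_def by (rule finite_subset[of _ "{..N}"]) auto
  have "real N * ln (real N) - real N \<le> real N * (\<Sum>d = 1..N. mangoldt d / real d)"
    using ln_fact_ge[OF N] ln_fact_le_mangoldt_sum[of N] by linarith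
  then have "real N * (ln (real N) - 1) \<le> real N * (\<Sum>d = 1..N. mangoldt d / real d)"
    by (simp add: algebra_simps)
  then have "ln (real N) - 1 \<le> (\<Sum>d = 1..N. mangoldt d / real d)"
    using N by simp
  also have "\<dots> \<le> (\<Sum>p\<in>P. ln (real p) / (real p - 1))"
    unfolding P_def by (rule mangoldt_sum_le_primes)
  also have "\<dots> = (\<Sum>p\<in>P. ln (real p) / real p) + (\<Sum>p\<in>P. ln (real p) / (real p * (real p - 1)))"
    unfolding sum.distrib[symmetric]
  proof (rule sum.cong[OF refl])
    fix p assume "p \<in> P"
    then have "real p \<ge> 2" using prime_ge_2_nat unfolding P_def by auto
    then show "ln (real p) / (real p - 1) = ln (real p) / real p + ln (real p) / (real p * (real p - 1))"
      by (simp add: field_simps)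
  qed
  also have "(\<Sum>p\<in>P. ln (real p) / (real p * (real p - 1))) \<le> (\<Sum>k = 2..N. ln (real k) / (real k * (real k - 1)))"
    unfolding P_def by (intro sum_mono2) (auto dest: prime_ge_2_nat)
  also have "\<dots> \<le> ln 2 + 2 - (ln (real N + 1) + 2) / real N" by (rule sum_ln_over_pronic_le[OF N])
  also have "\<dots> \<le> 3"
  proof -
    have "(ln (real N + 1) + 2) / real N \<ge> 0" by (intro divide_nonneg_nonneg add_nonneg_nonneg) auto
    moreover have "ln 2 \<le> (1 :: real)" using ln_le_minus_one[of 2] by simp
    ultimately show ?thesis by linarith
  qed
  also have "(\<Sum>p\<in>P. ln (real p) / real p) \<le> (\<Sum>p\<in>insert 2 (odd_primes_upto (real N)). ln (real p) / real p)"
    unfolding P_def odd_primes_upto_def[of "real N"]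
    by (intro sum_mono2) (auto simp: odd_primes_upto_def[symmetric] dest: prime_ge_2_nat)
  also have "\<dots> = ln 2 / 2 + (\<Sum>p\<in>odd_primes_upto (real N). ln (real p) / real p)"
    by (subst sum.insert) (auto simp: odd_primes_upto_def)
  also have "ln 2 / 2 \<le> (1 :: real)" using ln_le_minus_one[of 2] by simp
  finally show ?thesis by simp
qed

section \<open>The logarithmic deficit of the primes\<close>

text \<open>For odd primes this is \<pi>(x) ln x - \<theta>(x), or the integral of \<pi>(t) / t. It
  is continuous in x, since a prime enters with the term ln 1.\<close>

definition log_prime_deficit :: "real \<Rightarrow> real" where
  "log_prime_deficit x = (\<Sum>p\<in>odd_primes_upto x. ln (x / real p))"

text \<open>Each prime up to x contributes at least ln e = 1 to the deficit at e x. An upper bound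
  on the deficit thus implies one of Chebyshev type on the number of primes.\<close>

lemma card_odd_primes_upto_le_deficit:
  assumes x: "x > 0"
  shows "real (card (odd_primes_upto x)) \<le> log_prime_deficit (exp 1 * x)"
proof -
  have "real (card (odd_primes_upto x)) = (\<Sum>p\<in>odd_primes_upto x. 1)" by simp
  also have "\<dots> \<le> (\<Sum>p\<in>odd_primes_upto x. ln (exp 1 * x / real p))"
  proof (rule sum_mono)
    fix p assume p: "p \<in> odd_primes_upto x"
    then have "real p > 0" "real p \<le> x" using odd_primes_upto_ge_3[OF p] unfolding odd_primes_upto_def by auto
    then have "exp 1 \<le> exp 1 * x / real p" by (simp add: field_simps)
    then have "ln (exp 1) \<le> ln (exp 1 * x / real p)" by (intro ln_mono) auto
    then show "1 \<le> ln (exp 1 * x / real p)" by simp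
  qed
  also have "\<dots> \<le> log_prime_deficit (exp 1 * x)" unfolding log_prime_deficit_def
  proof (rule sum_mono2)
    have "x \<le> exp 1 * x" using x by simp
    then show "odd_primes_upto x \<subseteq> odd_primes_upto (exp 1 * x)" unfolding odd_primes_upto_def by auto
    show "0 \<le> ln (exp 1 * x / real p)" if "p \<in> odd_primes_upto (exp 1 * x) - odd_primes_upto x" for p
      using that odd_primes_upto_ge_3[of p "exp 1 * x"] unfolding odd_primes_upto_def by (auto intro!: ln_ge_zero simp: field_simps)
  qed simp
  finally show ?thesis .
qed

text \<open>The first order Taylor remainder at u = ln t of the function u exp (-u), evaluated at ln
  p. It vanishes at t = p, and its derivative in t has the factor ln (t / p), whose sum over p is
  the deficit: summation by parts in differential form.\<close>

definition mertens_kernel :: "nat \<Rightarrow> real \<Rightarrow> real" where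
  "mertens_kernel p t = ln (real p) / real p - ln t / t - ln (t / real p) * (ln t - 1) / t"

lemma mertens_kernel_deriv:
  assumes p: "p > 0" and t: "t > 0"
  shows "(mertens_kernel p has_real_derivative ln (t / real p) * (ln t - 2) / t\<^sup>2) (at t)"
proof -
  have "((\<lambda>t. ln (real p) / real p - ln t / t - (ln t - ln (real p)) * (ln t - 1) / t)
      has_real_derivative (ln t - ln (real p)) * (ln t - 2) / t\<^sup>2) (at t)"
    using t by (auto intro!: derivative_eq_intros simp: field_simps power2_eq_square)
  moreover have "\<forall>\<^sub>F s in nhds t. mertens_kernel p s
      = ln (real p) / real p - ln s / s - (ln s - ln (real p)) * (ln s - 1) / s"
    using eventually_nhds_in_open[of "{0<..}" t] t p
    by (auto simp: mertens_kernel_def ln_div elim!: eventually_mono)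
  ultimately show ?thesis using p t by (subst DERIV_cong_ev[OF refl _ refl]) (auto simp: ln_div)
qed

lemma log_prime_deficit_between:
  assumes "real N \<le> t" "t \<le> real N + 1" "N \<ge> 1"
  shows "log_prime_deficit t = (\<Sum>p\<in>odd_primes_upto (real N). ln (t / real p))"
  unfolding log_prime_deficit_def
proof (rule sum.mono_neutral_right)
  show "odd_primes_upto (real N) \<subseteq> odd_primes_upto t" using assms unfolding odd_primes_upto_def by auto
  show "\<forall>p\<in>odd_primes_upto t - odd_primes_upto (real N). ln (t / real p) = 0"
  proof
    fix p assume "p \<in> odd_primes_upto t - odd_primes_upto (real N)"
    then have "real p \<le> t" "p > N" unfolding odd_primes_upto_def by auto
    then have "t = real p" using assms by linarith
    then show "ln (t / real p) = 0" using \<open>p > N\<close> by simp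
  qed
qed simp

text \<open>Under the contrary bound, the sum \<open>\<Psi>\<close> of the kernels grows at most
  like ln t - ln (ln t) / 2. What separates it from the sum of ln p / p is bounded, so Mertens'
  lower bound fails.\<close>

lemma deficit_exceeds_infinitely_often:
  "\<exists>x\<ge>x0. log_prime_deficit x > x / ln x * (1 + 3 / 2 / ln x)"
proof (rule ccontr)
  assume "\<not> ?thesis"
  then have le0: "log_prime_deficit x \<le> x / ln x * (1 + 3 / 2 / ln x)" if "x \<ge> x0" for x
    using that by force
  \<comment> \<open>From exp 2 on, the factor (ln t - 2) / t^2 is nonnegative, so the assumed bound
    on the deficit may be multiplied by it.\<close>
  define N0 where "N0 = nat \<lceil>max x0 (exp 2)\<rceil>"
  have N0: "real N0 \<ge> x0" "real N0 \<ge> exp 2" unfolding N0_def by linarith+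
  have e2: "exp 2 > (1 :: real)" by simp
  have le: "log_prime_deficit x \<le> x / ln x * (1 + 3 / 2 / ln x)" "ln x \<ge> 2" "x > 1" if "x \<ge> real N0" for x
  proof -
    show "log_prime_deficit x \<le> x / ln x * (1 + 3 / 2 / ln x)" using le0 that N0 by simp
    show "x > 1" using that N0 e2 by linarith
    then show "ln x \<ge> 2" using that N0 ln_ge_iff[of x 2] by linarith
  qed
  \<comment> \<open>An antiderivative of (1 - 1 / (2 ln t)) / t, which is (1 + 3 / (2 ln t)) (1 - 2
    / ln t) / t without its negative term in 1 / (ln t)^2.\<close>
  define Q where "Q t = ln t - ln (ln t) / 2" for t :: real
  define \<Psi> where "\<Psi> N t = (\<Sum>p\<in>odd_primes_upto (real N). mertens_kernel p t)" for N t
  have step: "\<Psi> (Suc N) (real (Suc N)) - Q (real (Suc N)) \<le> \<Psi> N (real N) - Q (real N)" if N: "N \<ge> N0" for N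
  proof -
    have N1: "N \<ge> 1" using le(3)[of "real N"] N by simp
    have "\<Psi> N (real N + 1) - Q (real N + 1) \<le> \<Psi> N (real N) - Q (real N)"
    proof (rule DERIV_nonpos_imp_nonincreasing[where f = "\<lambda>t. \<Psi> N t - Q t"])
      fix t assume t: "real N \<le> t" "t \<le> real N + 1"
      then have tN0: "t \<ge> N0" using N by simp
      note L = le[OF tN0]
      have d\<Psi>: "(\<Psi> N has_real_derivative (\<Sum>p\<in>odd_primes_upto (real N). ln (t / real p) * (ln t - 2) / t\<^sup>2)) (at t)"
        unfolding \<Psi>_def using L by (intro DERIV_sum mertens_kernel_deriv) (auto dest: odd_primes_upto_ge_3)
      have dQ: "(Q has_real_derivative 1 / t - 1 / (2 * (t * ln t))) (at t)"
        unfolding Q_def using L by (auto intro!: derivative_eq_intros simp: field_simps)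
      have "(\<Sum>p\<in>odd_primes_upto (real N). ln (t / real p) * (ln t - 2) / t\<^sup>2)
          = log_prime_deficit t * ((ln t - 2) / t\<^sup>2)"
        unfolding log_prime_deficit_between[OF t N1] sum_distrib_right by simp
      also have "\<dots> \<le> (t / ln t * (1 + 3 / 2 / ln t)) * ((ln t - 2) / t\<^sup>2)"
        using L by (intro mult_right_mono) auto
      also have "\<dots> = 1 / t * (1 - 1 / 2 / ln t - 3 / (ln t)\<^sup>2)"
        using L by (simp add: field_simps power2_eq_square)
      also have "\<dots> \<le> 1 / t * (1 - 1 / 2 / ln t)"
        using L by (intro mult_left_mono) auto
      also have "\<dots> = 1 / t - 1 / (2 * (t * ln t))" using L by (simp add: field_simps)
      finally have "(\<Sum>p\<in>odd_primes_upto (real N). ln (t / real p) * (ln t - 2) / t\<^sup>2)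
          - (1 / t - 1 / (2 * (t * ln t))) \<le> 0" by simp
      then show "\<exists>y. ((\<lambda>t. \<Psi> N t - Q t) has_real_derivative y) (at t) \<and> y \<le> 0"
        using DERIV_diff[OF d\<Psi> dQ] by blast
    qed simp
    moreover have "\<Psi> (Suc N) (real (Suc N)) = \<Psi> N (real N + 1)"
    proof -
      have "odd_primes_upto (real N) \<subseteq> odd_primes_upto (real (Suc N))" unfolding odd_primes_upto_def by auto
      \<comment> \<open>A prime N + 1 joins the sum exactly where its kernel vanishes, so there is
        no jump.\<close>
      moreover have "mertens_kernel p (real (Suc N)) = 0"
        if "p \<in> odd_primes_upto (real (Suc N)) - odd_primes_upto (real N)" for p
      proof -
        have "p = Suc N" using that unfolding odd_primes_upto_def by auto
        then show ?thesis unfolding mertens_kernel_def by simp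
      qed
      ultimately have "\<Psi> N (real (Suc N)) = \<Psi> (Suc N) (real (Suc N))"
        unfolding \<Psi>_def by (intro sum.mono_neutral_left) auto
      then show ?thesis by (simp add: add.commute)
    qed
    ultimately show ?thesis by (simp add: add.commute)
  qed
  define C where "C = \<Psi> N0 (real N0) - Q (real N0)"
  have \<Psi>_le: "\<Psi> N (real N) \<le> Q (real N) + C" if "N \<ge> N0" for N
    using that
  proof (induction N rule: nat_induct_at_least)
    case base
    show ?case unfolding C_def by simp
  next
    case (Suc n)
    then show ?case using step[of n] by linarith
  qed
  \<comment> \<open>Here 5 comes from Mertens' bound, 2 e from the number of primes times ln x / x,
    and the last 2 from the deficit times (ln x - 1) / x.\<close>
  have bounded: "ln (ln (real N)) \<le> 2 * (C + 5 + 2 * exp 1 + 2)" if N: "N \<ge> N0" for N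
  proof -
    define x where "x = real N"
    have xN: "x \<ge> N0" using N unfolding x_def by simp
    note L = le[OF xN]
    have N1: "N \<ge> 1" using L unfolding x_def by simp
    have ex: "exp 1 * x \<ge> N0"
    proof -
      have "1 * x \<le> exp 1 * x" using L by (intro mult_right_mono) auto
      then show ?thesis using xN by simp
    qed
    note Le = le[OF ex]
    have two: "1 + 3 / 2 / ln y \<le> 2" if "ln y \<ge> 2" for y :: real
      using that by (simp add: field_simps)
    have card: "real (card (odd_primes_upto x)) \<le> 2 * exp 1 * x / ln x"
    proof -
      have "real (card (odd_primes_upto x)) \<le> log_prime_deficit (exp 1 * x)"
        using L by (intro card_odd_primes_upto_le_deficit) auto
      also have "\<dots> \<le> (exp 1 * x) / ln (exp 1 * x) * (1 + 3 / 2 / ln (exp 1 * x))" by (rule Le(1))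
      also have "\<dots> \<le> (exp 1 * x) / ln (exp 1 * x) * 2"
        using Le L two[OF Le(2)] by (intro mult_left_mono) auto
      also have "\<dots> \<le> (exp 1 * x) / ln x * 2"
        using L by (intro mult_right_mono divide_left_mono) (auto simp: ln_mult)
      finally show ?thesis by (simp add: mult_ac)
    qed
    have "ln x - 5 \<le> (\<Sum>p\<in>odd_primes_upto x. ln (real p) / real p)"
      unfolding x_def by (rule mertens_lower_bound[OF N1])
    also have "\<dots> = (\<Sum>p\<in>odd_primes_upto x. mertens_kernel p x + ln x / x + ln (x / real p) * ((ln x - 1) / x))"
      unfolding mertens_kernel_def by simp
    also have "\<dots> = \<Psi> N x + real (card (odd_primes_upto x)) * (ln x / x) + log_prime_deficit x * ((ln x - 1) / x)"
      unfolding sum.distrib \<Psi>_def log_prime_deficit_def sum_distrib_right x_def by simp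
    also have "\<dots> \<le> (Q x + C) + (2 * exp 1 * x / ln x) * (ln x / x) + (x / ln x * (1 + 3 / 2 / ln x)) * ((ln x - 1) / x)"
      using card L \<Psi>_le[OF N] unfolding x_def[symmetric] by (intro add_mono mult_right_mono) auto
    also have "(2 * exp 1 * x / ln x) * (ln x / x) = 2 * exp 1" using L by simp
    also have "(x / ln x * (1 + 3 / 2 / ln x)) * ((ln x - 1) / x) \<le> (x / ln x * 2) * (ln x / x)"
      using L two[OF L(2)] by (intro mult_mono) (auto intro: divide_right_mono)
    also have "(x / ln x * 2) * (ln x / x) = 2" using L by simp
    finally show ?thesis unfolding Q_def x_def by simp
  qed
  have "filterlim (\<lambda>N. ln (ln (real N))) at_top sequentially" by real_asymp
  then have "\<forall>\<^sub>F N in sequentially. ln (ln (real N)) > 2 * (C + 5 + 2 * exp 1 + 2)"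
    by (rule filterlim_at_top_dense[THEN iffD1, rule_format])
  then have "\<forall>\<^sub>F N in sequentially. False"
    using eventually_ge_at_top[of N0] by eventually_elim (use bounded in force)
  then show False by simp
qed

section \<open>From short lattice vectors to abc triples\<close>

lemma prod_Un_le:
  fixes f :: "'a \<Rightarrow> nat"
  assumes "finite A" "finite B" and pos: "\<And>x. x \<in> A \<union> B \<Longrightarrow> f x \<ge> 1"
  shows "prod f (A \<union> B) \<le> prod f A * prod f B"
proof -
  have "1 \<le> prod f (A \<inter> B)" by (rule prod_ge_1) (use pos in blast)
  then have "prod f (A \<union> B) * 1 \<le> prod f (A \<union> B) * prod f (A \<inter> B)" by (rule mult_le_mono2)
  then show ?thesis using prod.union_inter[OF assms(1,2), of f] by simp
qed

lemma rad_le: "N > 0 \<Longrightarrow> rad N \<le> N"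
proof -
  assume N: "N > 0"
  have "rad N \<le> (\<Prod>p\<in>prime_factors N. p ^ multiplicity p N)"
    unfolding rad_def
    by (intro prod_mono) (auto simp: prime_factors_multiplicity intro!: self_le_power prime_ge_1_nat)
  also have "\<dots> = N" using N by (intro prime_factorization_nat[symmetric]) simp
  finally show ?thesis .
qed

text \<open>With a = 2^m a', the radical of abc divides the product over {2}, the primes of a' and
  P, and rad a' \<le> a' = a / 2^m.\<close>

lemma rad_mult_le:
  assumes P: "finite P" "\<And>p. p \<in> P \<Longrightarrow> prime p" and pos: "a > 0" "b > 0" "c > 0"
    and pf: "prime_factors b \<subseteq> P" "prime_factors c \<subseteq> P" and dvd: "2 ^ m dvd a"
  shows "rad (a * b * c) * 2 ^ m \<le> 2 * a * \<Prod>P"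
proof -
  obtain a' where a': "a = 2 ^ m * a'" using dvd by blast
  have a'0: "a' > 0" using a' pos by (auto intro: Nat.gr0I)
  have "prime_factors a \<subseteq> insert 2 (prime_factors a')"
  proof
    fix p assume "p \<in> prime_factors a"
    then have p: "prime p" "p dvd 2 ^ m * a'" unfolding a' by auto
    then have "p dvd 2 \<or> p dvd a'" by (metis prime_dvd_mult_iff prime_dvd_power)
    then show "p \<in> insert 2 (prime_factors a')"
      using p(1) a'0 primes_dvd_imp_eq[OF p(1) two_is_prime_nat] by (auto simp: prime_factors_dvd)
  qed
  then have sub: "prime_factors (a * b * c) \<subseteq> ({2} \<union> prime_factors a') \<union> P"
    using pf pos by (auto simp: prime_factors_product)
  have one: "p \<ge> 1" if "p \<in> ({2} \<union> prime_factors a') \<union> P" for p :: nat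
  proof -
    have "prime p" using that P(2) by auto
    then show ?thesis using prime_gt_0_nat by (simp add: Suc_le_eq)
  qed
  have "rad (a * b * c) \<le> \<Prod>(({2} \<union> prime_factors a') \<union> P)"
    unfolding rad_def
  proof (rule dvd_imp_le)
    show "\<Prod>(prime_factors (a * b * c)) dvd \<Prod>(({2} \<union> prime_factors a') \<union> P)"
      using P(1) sub by (intro prod_dvd_prod_subset) auto
    show "\<Prod>(({2} \<union> prime_factors a') \<union> P) > 0"
      using one by (intro prod_pos) fastforce
  qed
  also have "\<dots> \<le> \<Prod>({2} \<union> prime_factors a') * \<Prod>P"
    using P(1) one by (intro prod_Un_le) auto
  also have "\<dots> \<le> (\<Prod>{2} * \<Prod>(prime_factors a')) * \<Prod>P"
    using one by (intro mult_le_mono1 prod_Un_le) auto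
  also have "\<dots> \<le> (2 * a') * \<Prod>P"
    using rad_le[OF a'0] unfolding rad_def by (intro mult_le_mono1 mult_le_mono) auto
  finally have "rad (a * b * c) * 2 ^ m \<le> (2 * a' * \<Prod>P) * 2 ^ m" by (rule mult_le_mono1)
  then show ?thesis unfolding a' by (simp add: mult_ac)
qed

text \<open>The lattice attached to odd primes \<open>q i\<close>: its last coordinate \<open>\<Sum>v i ln q i + M v n\<close>
  turns the norm \<open>\<Sum>|v i| ln q i\<close>, which is \<open>ln X + ln Y\<close> for the positive and
  negative parts of \<open>\<Prod>q i ^ v i = X / Y\<close>, into \<open>2 ln (max X Y)\<close>.\<close>

locale prime_lattice =
  fixes n :: nat and q :: "nat \<Rightarrow> nat" and m :: nat and M :: real
  assumes inj: "inj_on q {..<n}"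
    and prime: "\<And>i. i < n \<Longrightarrow> prime (q i)"
    and odd: "\<And>i. i < n \<Longrightarrow> q i \<noteq> 2"
    and M: "M > 0"
begin

text \<open>The numerator of the fraction with exponents v, as \<open>nat\<close> discards negative
  ones; at -v it is the denominator.\<close>

definition prime_product :: "(nat \<Rightarrow> int) \<Rightarrow> nat" where
  "prime_product v = (\<Prod>i<n. q i ^ nat (v i))"

definition lattice_mat :: "real mat" where
  "lattice_mat = mat (n + 1) (n + 1) (\<lambda>(i, j). if i = n then (if j = n then M else ln (q j))
     else if i = j then ln (q i) else 0)"

text \<open>Comparing numerator and denominator expresses that the fraction is 1 modulo 2^m without
  modular inverses. Coordinate n is left free.\<close>

definition kernel :: "(nat \<Rightarrow> int) set" where
  "kernel = {v. (\<forall>i\<ge>n + 1. v i = 0) \<and>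
     [prime_product v = prime_product (\<lambda>i. - v i)] (mod 2 ^ m)}"

lemma ln_q: "i < n \<Longrightarrow> ln (q i) > 0"
  using prime[of i] prime_ge_2_nat[of "q i"] by simp

lemma prime_product_pos: "prime_product v > 0"
  unfolding prime_product_def using prime by (intro prod_pos) (auto intro: prime_gt_0_nat)

lemma coprime_prime_product: "coprime (prime_product v) (2 ^ m)"
proof -
  have "coprime (q i) 2" if "i < n" for i
    using primes_coprime[OF prime[OF that] two_is_prime_nat odd[OF that]] .
  then show ?thesis unfolding prime_product_def by (intro prod_coprime_left) auto
qed

text \<open>Multiplicativity of the fractions with denominators cleared; on exponents, both sides
  agree because nat z - nat (-z) = z.\<close>

lemma prime_product_diff:
  "prime_product (\<lambda>i. u i - v i) * (prime_product (\<lambda>i. - u i) * prime_product v)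
   = prime_product (\<lambda>i. - (u i - v i)) * (prime_product u * prime_product (\<lambda>i. - v i))"
  unfolding prime_product_def prod.distrib[symmetric] power_add[symmetric]
  by (intro prod.cong refl arg_cong2[of _ _ _ _ "(^)"]) auto

text \<open>A common factor X is cancelled modulo 2^m, which is allowed because all
  \<open>q i\<close> are odd.\<close>

lemma int_lattice_kernel: "int_lattice (n + 1) kernel"
proof -
  have "(\<lambda>i. u i - v i) \<in> kernel" if u: "u \<in> kernel" and v: "v \<in> kernel" for u v
  proof -
    let ?w = "\<lambda>i. u i - v i"
    define X where "X = prime_product u * prime_product v"
    have cu: "[prime_product u = prime_product (\<lambda>i. - u i)] (mod 2 ^ m)"
      and cv: "[prime_product v = prime_product (\<lambda>i. - v i)] (mod 2 ^ m)"
      using u v unfolding kernel_def by auto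
    have "[prime_product ?w * X = prime_product ?w * (prime_product (\<lambda>i. - u i) * prime_product v)] (mod 2 ^ m)"
      unfolding X_def by (intro cong_mult cong_refl cu)
    also have "prime_product ?w * (prime_product (\<lambda>i. - u i) * prime_product v)
      = prime_product (\<lambda>i. - ?w i) * (prime_product u * prime_product (\<lambda>i. - v i))"
      by (rule prime_product_diff)
    also have "[\<dots> = prime_product (\<lambda>i. - ?w i) * X] (mod 2 ^ m)"
      unfolding X_def by (intro cong_mult cong_refl cong_sym[OF cv])
    finally have "[prime_product ?w * X = prime_product (\<lambda>i. - ?w i) * X] (mod 2 ^ m)" .
    moreover have "coprime X (2 ^ m)"
      unfolding X_def coprime_mult_left_iff by (intro conjI coprime_prime_product)
    ultimately have "[prime_product ?w = prime_product (\<lambda>i. - ?w i)] (mod 2 ^ m)"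
      using cong_mult_rcancel_nat by blast
    then show ?thesis using u v unfolding kernel_def by auto
  qed
  moreover have "(\<lambda>i. 0) \<in> kernel" unfolding kernel_def by simp
  ultimately show ?thesis unfolding int_lattice_def by (auto simp: kernel_def)
qed

text \<open>For nonnegative exponents the denominators are 1, so the residue of
  \<open>prime_product\<close> is a coset label and the index is at most 2^m.\<close>

lemma kernel_if_cong:
  assumes u: "u \<in> nonneg_vecs (n + 1)" and v: "v \<in> nonneg_vecs (n + 1)"
    and eq: "prime_product u mod 2 ^ m = prime_product v mod 2 ^ m"
  shows "(\<lambda>i. u i - v i) \<in> kernel"
proof -
  let ?w = "\<lambda>i. u i - v i"
  have "prime_product (\<lambda>i. - u i) = 1" "prime_product (\<lambda>i. - v i) = 1"
    using u v unfolding prime_product_def nonneg_vecs_def by auto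
  then have *: "prime_product ?w * prime_product v = prime_product (\<lambda>i. - ?w i) * prime_product u"
    using prime_product_diff[of u v] by simp
  have "[prime_product u = prime_product v] (mod 2 ^ m)" using eq by (simp add: Cong.cong_def)
  then have "[prime_product ?w * prime_product v = prime_product (\<lambda>i. - ?w i) * prime_product v] (mod 2 ^ m)"
    unfolding * by (intro cong_mult cong_refl)
  then have "[prime_product ?w = prime_product (\<lambda>i. - ?w i)] (mod 2 ^ m)"
    using cong_mult_rcancel_nat[OF coprime_prime_product] by blast
  then show ?thesis using u v unfolding kernel_def nonneg_vecs_def by auto
qed

lemma lattice_mat: "lattice_mat \<in> carrier_mat (n + 1) (n + 1)"
  unfolding lattice_mat_def by simp

lemma det_lattice_mat: "det lattice_mat = M * (\<Prod>i<n. ln (q i))"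
proof -
  have "det lattice_mat = prod_list (diag_mat lattice_mat)"
    by (rule det_lower_triangular[OF _ lattice_mat]) (auto simp: lattice_mat_def)
  also have "\<dots> = (\<Prod>i<n + 1. lattice_mat $$ (i, i))"
    unfolding prod_list_diag_prod using lattice_mat by (simp add: atLeast0LessThan)
  also have "\<dots> = M * (\<Prod>i<n. ln (q i))" unfolding lattice_mat_def by simp
  finally show ?thesis .
qed

lemma l1_norm_lattice_mat:
  "l1_norm (lattice_mat *\<^sub>v vec (n + 1) (\<lambda>i. real_of_int (v i)))
   = (\<Sum>i<n. \<bar>real_of_int (v i)\<bar> * ln (q i)) + \<bar>(\<Sum>i<n. real_of_int (v i) * ln (q i)) + M * v n\<bar>"
proof -
  let ?x = "lattice_mat *\<^sub>v vec (n + 1) (\<lambda>i. real_of_int (v i))"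
  have x: "?x $ i = (\<Sum>j<n. lattice_mat $$ (i, j) * v j) + lattice_mat $$ (i, n) * v n" if "i < n + 1" for i
    using that lattice_mat by (simp add: scalar_prod_def atLeast0LessThan)
  have "?x $ i = ln (q i) * v i" if i: "i < n" for i
  proof -
    have "(\<Sum>j<n. lattice_mat $$ (i, j) * v j) = (\<Sum>j<n. if i = j then ln (q i) * v i else 0)"
      using i by (intro sum.cong) (auto simp: lattice_mat_def)
    then show ?thesis using x[of i] i by (simp add: lattice_mat_def)
  qed
  then have 1: "(\<Sum>i<n. \<bar>?x $ i\<bar>) = (\<Sum>i<n. \<bar>real_of_int (v i)\<bar> * ln (q i))"
    using ln_q by (intro sum.cong) (auto simp: abs_mult abs_of_pos mult.commute)
  have 2: "?x $ n = (\<Sum>i<n. real_of_int (v i) * ln (q i)) + M * v n"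
    using x[of n] by (simp add: lattice_mat_def mult.commute)
  have "l1_norm ?x = (\<Sum>i<n. \<bar>?x $ i\<bar>) + \<bar>?x $ n\<bar>"
    unfolding l1_norm_def using lattice_mat by simp
  then show ?thesis unfolding 1 2 .
qed

lemma ln_prime_product: "ln (prime_product v) = (\<Sum>i<n. nat (v i) * ln (q i))"
  unfolding prime_product_def of_nat_prod
  using prime by (subst ln_prod) (auto simp: ln_realpow prime_gt_0_nat)

lemma coprime_prime_product_uminus: "coprime (prime_product v) (prime_product (\<lambda>i. - v i))"
  unfolding prime_product_def
proof (intro prod_coprime_left prod_coprime_right)
  fix i j assume ij: "i \<in> {..<n}" "j \<in> {..<n}"
  show "coprime (q i ^ nat (v i)) (q j ^ nat (- v j))"
  proof (cases "i = j")
    case False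
    then have "q i \<noteq> q j" using inj ij by (auto simp: inj_on_def)
    then have "coprime (q i) (q j)" using ij prime by (intro primes_coprime) auto
    then show ?thesis by simp
  qed (cases "v i \<ge> 0"; simp)
qed

lemma prime_factors_prime_product: "prime_factors (prime_product v) \<subseteq> q ` {..<n}"
proof
  fix p assume p: "p \<in> prime_factors (prime_product v)"
  then have "prime p" "p dvd prime_product v" by auto
  then obtain i where i: "i < n" "p dvd q i ^ nat (v i)"
    unfolding prime_product_def by (auto simp: prime_dvd_prod_iff)
  then have "p dvd q i" using \<open>prime p\<close> prime_dvd_power by blast
  then have "p = q i" using \<open>prime p\<close> prime[OF i(1)] primes_dvd_imp_eq by blast
  then show "p \<in> q ` {..<n}" using i by auto
qed

text \<open>As |t| \<le> s, the norm s + |t + M v n| is at least M |v n|, which forces v n = 0. The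
  norm is then s + |t| = 2 ln (max X Y), and the difference of X and Y supplies the multiple of
  2^m.\<close>

lemma abc_triple_of_short_vector:
  assumes v: "v \<in> kernel" and nz: "v \<noteq> (\<lambda>i. 0)"
    and short: "l1_norm (lattice_mat *\<^sub>v vec (n + 1) (\<lambda>i. real_of_int (v i))) < M"
  shows "\<exists>a b c. abc_triple a b c \<and> 2 ^ m \<le> c \<and> 2 * ln (real c) < M \<and>
    rad (a * b * c) * 2 ^ m \<le> 2 * c * \<Prod>(q ` {..<n})"
proof -
  define s where "s = (\<Sum>i<n. \<bar>real_of_int (v i)\<bar> * ln (q i))"
  define t where "t = (\<Sum>i<n. real_of_int (v i) * ln (q i))"
  have ts: "\<bar>t\<bar> \<le> s" unfolding s_def t_def using ln_q
    by (intro order_trans[OF sum_abs] sum_mono) (auto simp: abs_mult abs_of_pos)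
  have norm: "s + \<bar>t + M * v n\<bar> < M" using short unfolding l1_norm_lattice_mat s_def t_def .
  have vn: "v n = 0"
  proof (rule ccontr)
    assume "v n \<noteq> 0"
    then have "1 \<le> \<bar>real_of_int (v n)\<bar>" by linarith
    then have "M * 1 \<le> M * \<bar>real_of_int (v n)\<bar>" using M by (intro mult_left_mono) auto
    then have "M \<le> \<bar>M * v n\<bar>" using M by (simp add: abs_mult)
    then show False using norm ts by linarith
  qed
  define X where "X = prime_product v"
  define Y where "Y = prime_product (\<lambda>i. - v i)"
  have XY0: "X > 0" "Y > 0" unfolding X_def Y_def by (rule prime_product_pos)+
  have parts: "real (nat k) + real (nat (- k)) = \<bar>real_of_int k\<bar>"
    "real (nat k) - real (nat (- k)) = real_of_int k" for k
    by (cases "k \<ge> 0"; simp)+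
  have lnXY: "ln (real X) + ln (real Y) = s" "ln (real X) - ln (real Y) = t"
    unfolding X_def Y_def ln_prime_product s_def t_def sum.distrib[symmetric] sum_subtractf[symmetric]
    by (simp_all only: parts(1)[symmetric] distrib_right) (simp_all only: parts(2)[symmetric] left_diff_distrib)
  have cop: "coprime X Y" unfolding X_def Y_def by (rule coprime_prime_product_uminus)
  have "X \<noteq> Y"
  \<comment> \<open>Coprime equal numbers are 1, so s = 0, against a nonzero exponent.\<close>
  proof
    assume "X = Y"
    then have "X = 1" "Y = 1" using cop by auto
    then have "s = 0" using lnXY by simp
    obtain i where i: "v i \<noteq> 0" using nz by (auto simp: fun_eq_iff)
    then have "i < n" using vn v unfolding kernel_def
      by (metis (mono_tags, lifting) Suc_eq_plus1 linorder_neqE_nat mem_Collect_eq not_less_eq_eq le_simps(3))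
    then have "\<bar>real_of_int (v i)\<bar> * ln (q i) \<le> s" unfolding s_def
      using ln_q by (intro member_le_sum mult_nonneg_nonneg) (auto intro: less_imp_le)
    then show False using \<open>s = 0\<close> i ln_q[OF \<open>i < n\<close>] by (auto simp: mult_le_0_iff)
  qed
  define b c where "b = min X Y" and "c = max X Y"
  define a where "a = c - b"
  have abc: "a > 0" "b > 0" "c > 0" "a + b = c"
    using XY0 \<open>X \<noteq> Y\<close> unfolding a_def b_def c_def by auto
  have "coprime b c" using cop unfolding b_def c_def by (cases "X \<le> Y") (auto simp: coprime_commute)
  then have "Gcd {a, b, c} = 1" by (simp add: coprime_iff_gcd_eq_1)
  then have triple: "abc_triple a b c" unfolding abc_triple_def using abc by simp
  have "[X = Y] (mod 2 ^ m)" using v unfolding kernel_def X_def Y_def by auto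
  then have "[c = b] (mod 2 ^ m)" unfolding b_def c_def by (cases "X \<le> Y") (auto simp: cong_sym_eq)
  then have dvd: "2 ^ m dvd a" unfolding a_def using abc by (subst (asm) cong_altdef_nat) auto
  then have "2 ^ m \<le> a" using abc by (intro dvd_imp_le) auto
  then have c: "2 ^ m \<le> c" "a \<le> c" using abc by auto
  have "2 * ln (real c) = s + \<bar>t\<bar>"
  proof (cases "X \<le> Y")
    case True
    then have "ln (real X) \<le> ln (real Y)" using XY0 by simp
    then show ?thesis using lnXY True unfolding c_def by (simp add: max_absorb2)
  next
    case False
    then have "ln (real X) \<ge> ln (real Y)" using XY0 by simp
    then show ?thesis using lnXY False unfolding c_def by simp
  qed
  then have "2 * ln (real c) < M" using norm vn by simp
  moreover have "rad (a * b * c) * 2 ^ m \<le> 2 * a * \<Prod>(q ` {..<n})"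
  proof (rule rad_mult_le)
    show "prime_factors b \<subseteq> q ` {..<n}" "prime_factors c \<subseteq> q ` {..<n}"
      using prime_factors_prime_product unfolding b_def c_def X_def Y_def min_def max_def by auto
  qed (use prime abc dvd in auto)
  then have "rad (a * b * c) * 2 ^ m \<le> 2 * c * \<Prod>(q ` {..<n})"
    using c(2) by (meson mult_le_mono1 mult_le_mono2 order_trans)
  ultimately show ?thesis using triple c by blast
qed

text \<open>The hypothesis \<open>small\<close> places the norm guaranteed by d below M, as the
  covolume is at most |det| times 2^m.\<close>

lemma abc_triple_exists:
  assumes d: "admissible_l1_const (n + 1) d"
    and small: "d * (M * (\<Prod>i<n. ln (q i)) * 2 ^ m) powr (1 / real (n + 1)) < M"
  shows "\<exists>a b c. abc_triple a b c \<and> 2 ^ m \<le> c \<and> 2 * ln (real c) < M \<and>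
    rad (a * b * c) * 2 ^ m \<le> 2 * c * \<Prod>(q ` {..<n})"
proof -
  define L where "L = (\<lambda>v. lattice_mat *\<^sub>v vec (n + 1) (\<lambda>i. real_of_int (v i))) ` kernel"
  have pos: "(\<Prod>i<n. ln (q i)) > 0" using ln_q by (intro prod_pos) auto
  have det0: "det lattice_mat \<noteq> 0" unfolding det_lattice_mat using mult_pos_pos[OF M pos] by linarith
  have D: "\<forall>u\<in>nonneg_vecs (n + 1). prime_product u mod 2 ^ m \<in> {0..<2 ^ m}" by simp
  have inj: "\<forall>u\<in>nonneg_vecs (n + 1). \<forall>v\<in>nonneg_vecs (n + 1).
      prime_product u mod 2 ^ m = prime_product v mod 2 ^ m \<longrightarrow> (\<lambda>i. u i - v i) \<in> kernel"
    using kernel_if_cong by blast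
  note kl = kernel_lattice[OF lattice_mat det0 int_lattice_kernel finite_atLeastLessThan D inj, folded L_def]
  have cov: "lattice_covolume (n + 1) L \<le> M * (\<Prod>i<n. ln (q i)) * 2 ^ m"
    using kl(2) mult_pos_pos[OF M pos] unfolding det_lattice_mat by (simp add: abs_of_pos del: abs_mult)
  obtain x where x: "x \<in> L" "x \<noteq> 0\<^sub>v (n + 1)"
    "l1_norm x \<le> d * lattice_covolume (n + 1) L powr (1 / real (n + 1))"
    using d kl(1) unfolding admissible_l1_const_def by blast
  then obtain v where v: "v \<in> kernel" "x = lattice_mat *\<^sub>v vec (n + 1) (\<lambda>i. real_of_int (v i))"
    unfolding L_def by blast
  have "v \<noteq> (\<lambda>i. 0)"
  proof
    assume "v = (\<lambda>i. 0)"
    then have "x = 0\<^sub>v (n + 1)" unfolding v(2) using lattice_mat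
      by (intro eq_vecI) (auto simp: scalar_prod_def)
    then show False using x(2) by simp
  qed
  moreover have "l1_norm x < M"
  proof -
    have "d * lattice_covolume (n + 1) L powr (1 / real (n + 1))
        \<le> d * (M * (\<Prod>i<n. ln (q i)) * 2 ^ m) powr (1 / real (n + 1))"
      using d kl(3) cov unfolding admissible_l1_const_def by (intro mult_left_mono powr_mono2) auto
    then show ?thesis using x(3) small by linarith
  qed
  ultimately show ?thesis using abc_triple_of_short_vector[OF v(1)] v(2) by blast
qed

end

section \<open>Optimisation of the parameters\<close>

text \<open>In logarithms, \<open>small\<close> reads m < Z. The gain over the radical is 2^m / (2
  \<Prod>P), so the term 2 ln 2 pays once for this factor 2 and once for rounding Z.\<close>

lemma abc_triple_from_primes:
  assumes P: "finite P" and prime: "\<And>p. p \<in> P \<Longrightarrow> prime p" and odd: "2 \<notin> P"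
    and d: "admissible_l1_const (card P + 1) d" and M: "M > 0"
    and R: "R \<ge> 0" "R \<le> card P * ln M - real (card P + 1) * ln d
      - (\<Sum>p\<in>P. ln (ln (real p))) - (\<Sum>p\<in>P. ln (real p)) - 2 * ln 2"
  shows "\<exists>a b c. abc_triple a b c \<and> exp (\<Sum>p\<in>P. ln (real p)) \<le> real c \<and> 2 * ln (real c) < M \<and>
    exp R * rad (a * b * c) \<le> real c"
proof -
  define n where "n = card P"
  obtain q where bij: "bij_betw q {..<n} P"
    using ex_bij_betw_nat_finite[OF P] unfolding n_def atLeast0LessThan by blast
  have qP: "q i \<in> P" if "i < n" for i using bij that by (auto simp: bij_betw_def)
  define W where "W = (\<Sum>p\<in>P. ln (ln (real p)))"
  define S where "S = (\<Sum>p\<in>P. ln (real p))"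
  have p2: "real p \<ge> 2" if "p \<in> P" for p using prime[OF that] prime_ge_2_nat by auto
  have lnp: "ln (real p) > 0" if "p \<in> P" for p using p2[OF that] by simp
  have expW: "(\<Prod>i<n. ln (real (q i))) = exp W"
    unfolding W_def exp_sum[OF P]
    by (subst prod.reindex_bij_betw[OF bij, of "\<lambda>p. ln (real p)"]) (intro prod.cong refl exp_ln[OF lnp, symmetric])
  have expS: "real (\<Prod>P) = exp S"
    unfolding S_def exp_sum[OF P] of_nat_prod using p2 by (intro prod.cong) fastforce+
  have S0: "S \<ge> 0" unfolding S_def using p2 by (intro sum_nonneg) force
  have d0: "d > 0" using d unfolding admissible_l1_const_def by simp
  define Z where "Z = (n * ln M - real (n + 1) * ln d - W) / ln 2"
  have Z: "Z * ln 2 \<ge> R + S + 2 * ln 2" using R(2) unfolding Z_def n_def W_def S_def by simp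
  moreover have "ln 2 > (0 :: real)" by simp
  ultimately have "Z * ln 2 > 0" using R(1) S0 by linarith
  then have "Z > 0" by (simp add: zero_less_mult_iff)
  \<comment> \<open>The largest integer strictly below Z.\<close>
  define m where "m = nat (\<lceil>Z\<rceil> - 1)"
  have "real m = real_of_int (\<lceil>Z\<rceil> - 1)" unfolding m_def using \<open>Z > 0\<close> by simp
  then have m: "real m < Z" "Z \<le> real m + 1" by linarith+
  interpret prime_lattice n q m M
    by unfold_locales (use bij qP prime odd M in \<open>auto simp: bij_betw_def\<close>)
  have pow2: "(2 :: real) ^ m = exp (m * ln 2)" by (simp add: exp_of_nat_mult)
  have small: "d * (M * (\<Prod>i<n. ln (real (q i))) * 2 ^ m) powr (1 / real (n + 1)) < M"
  proof -
    have "M * (\<Prod>i<n. ln (real (q i))) * 2 ^ m = exp (ln M + W + m * ln 2)"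
      unfolding expW pow2 using M by (simp add: exp_add)
    moreover have "d * exp y powr (1 / real (n + 1)) = exp (ln d + y / real (n + 1))" for y
      using d0 by (simp add: powr_def exp_add)
    ultimately have "d * (M * (\<Prod>i<n. ln (real (q i))) * 2 ^ m) powr (1 / real (n + 1))
        = exp (ln d + (ln M + W + m * ln 2) / real (n + 1))" by (simp only:)
    also have "ln d + (ln M + W + m * ln 2) / real (n + 1) < ln M"
    proof -
      have "m * ln 2 < Z * ln 2" using m(1) by (intro mult_strict_right_mono) auto
      also have "\<dots> = n * ln M - real (n + 1) * ln d - W" unfolding Z_def by simp
      finally have "ln M + W + m * ln 2 < (ln M - ln d) * real (n + 1)" by (simp add: algebra_simps)
      then have "(ln M + W + m * ln 2) / real (n + 1) < ln M - ln d" by (simp add: field_simps)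
      then show ?thesis by simp
    qed
    then have "exp (ln d + (ln M + W + m * ln 2) / real (n + 1)) < exp (ln M)" by simp
    finally show ?thesis using M by simp
  qed
  obtain a b c where abc: "abc_triple a b c" "2 ^ m \<le> c" "2 * ln (real c) < M"
    "rad (a * b * c) * 2 ^ m \<le> 2 * c * \<Prod>(q ` {..<n})"
    using abc_triple_exists[OF _ small] d unfolding n_def by blast
  have "real (rad (a * b * c) * 2 ^ m) \<le> real (2 * c * \<Prod>P)"
    using abc(4) bij by (intro of_nat_mono) (simp add: bij_betw_def)
  then have rad: "rad (a * b * c) * exp (m * ln 2) \<le> 2 * real c * exp S"
    by (simp only: of_nat_mult of_nat_power of_nat_numeral pow2 expS)
  have "(Z - 1) * ln 2 \<le> m * ln 2" using m(2) by (intro mult_right_mono) auto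
  then have mR: "R + S + ln 2 \<le> m * ln 2" using Z by (simp add: algebra_simps)
  have "exp R * rad (a * b * c) * (2 * exp S) = rad (a * b * c) * exp (R + S + ln 2)"
    by (simp add: exp_add)
  also have "\<dots> \<le> rad (a * b * c) * exp (m * ln 2)" using mR by (intro mult_left_mono) auto
  also have "\<dots> \<le> real c * (2 * exp S)" using rad by (simp add: mult_ac)
  finally have "exp R * rad (a * b * c) \<le> real c" by (rule mult_right_le_imp_le) simp
  moreover have "exp S \<le> real c"
  proof -
    have "S \<le> m * ln 2" using mR R(1) \<open>ln 2 > (0 :: real)\<close> by linarith
    then have "exp S \<le> exp (m * ln 2)" by simp
    also have "\<dots> = real (2 ^ m)" using pow2 by simp
    also have "\<dots> \<le> real c" using abc(2) by (rule of_nat_mono)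
    finally show ?thesis .
  qed
  ultimately show ?thesis using abc unfolding S_def by blast
qed

text \<open>With y = ln u \<ge> 2 and z = ln w, z / y \<le> 1 + (z - y) / 2 \<le> exp ((z - y) / 2).
  It serves to replace ln c, known only through 2 ln c < M, by M / 2.\<close>

lemma sqrt_over_ln_mono:
  assumes u: "exp 2 \<le> u" "u \<le> (w :: real)"
  shows "sqrt u / ln u \<le> sqrt w / ln w"
proof -
  define y z where "y = ln u" and "z = ln w"
  have u0: "0 < u" "0 < w" using u exp_gt_zero[of "2 :: real"] by linarith+
  have y: "y \<ge> 2" unfolding y_def using u u0 by (simp add: ln_ge_iff)
  have yz: "y \<le> z" unfolding y_def z_def using u u0 by simp
  have sq: "sqrt u = exp (y / 2)" "sqrt w = exp (z / 2)"
    unfolding y_def z_def using u0 by (simp_all add: ln_sqrt[symmetric])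
  have "z / y = 1 + (z - y) / y" using y by (simp add: field_simps)
  also have "\<dots> \<le> 1 + (z - y) / 2" using y yz by (intro add_left_mono divide_left_mono) auto
  also have "\<dots> \<le> exp ((z - y) / 2)" by (rule exp_ge_add_one_self)
  finally have "exp (y / 2) * (z / y) \<le> exp (y / 2) * exp ((z - y) / 2)" by (intro mult_left_mono) auto
  also have "\<dots> = exp (z / 2)" unfolding exp_add[symmetric] by (simp add: field_simps)
  finally show ?thesis unfolding sq y_def[symmetric] z_def[symmetric] using y yz by (simp add: field_simps)
qed

lemma mult_ln_ge: "v > 0 \<Longrightarrow> v * ln v \<ge> v - (1 :: real)"
proof -
  assume v: "v > 0"
  have "ln (1 / v) \<le> 1 / v - 1" using v by (intro ln_le_minus_one) simp
  then have "v * (- ln v) \<le> v * (1 / v - 1)" using v by (intro mult_left_mono) (auto simp: ln_div)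
  then show ?thesis using v by (simp add: algebra_simps)
qed

lemma inverse_one_plus_le:
  assumes "\<eta> \<ge> - (1 / 2 :: real)"
  shows "1 / (1 + \<eta>) \<le> 1 - \<eta> + 2 * \<eta>\<^sup>2"
proof -
  have "0 \<le> \<eta>\<^sup>2 * (1 + 2 * \<eta>)" using assms by (intro mult_nonneg_nonneg) auto
  then have "1 \<le> (1 - \<eta> + 2 * \<eta>\<^sup>2) * (1 + \<eta>)" by (simp add: algebra_simps power2_eq_square)
  then show ?thesis using assms by (simp add: divide_le_eq)
qed

text \<open>The leading terms cancel at \<open>v = 1\<close>, and the first order terms in \<open>1 / L\<close> are
  controlled by \<open>v ln v \<ge> v - 1\<close>; this is where \<open>\<kappa> \<le> 3\<close> is needed.\<close>

lemma optimisation_inequality: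
  fixes \<kappa> :: real
  assumes \<kappa>: "\<kappa> \<le> 3"
  shows "\<forall>\<^sub>F L in at_top. \<forall>v\<ge>1 / L.
    4 * v * L / (2 * L + 2 * ln v + 1 - \<kappa>) \<le> v + v * ln v + 1 + (9 / 4) / L"
proof -
  \<comment> \<open>A bound for |2 ln v + 1 - \<kappa>| on the range 1 / L \<le> v < e. Its square
    is negligible against L, which disposes of the second order term.\<close>
  define K where "K L = 2 * ln L + 5 + \<bar>\<kappa>\<bar>" for L :: real
  have lim: "((\<lambda>L. 3 * (K L)\<^sup>2 / L) \<longlongrightarrow> 0) at_top" "((\<lambda>L. K L / L) \<longlongrightarrow> 0) at_top"
    unfolding K_def by real_asymp+
  have "\<forall>\<^sub>F L in at_top. 3 * (K L)\<^sup>2 / L < 1 / 4" and "\<forall>\<^sub>F L in at_top. K L / L < 1"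
    by (rule order_tendstoD(2)[OF lim(1)], simp) (rule order_tendstoD(2)[OF lim(2)], simp)
  then show ?thesis using eventually_gt_at_top[of 1]
  proof eventually_elim
    case (elim L)
    then have L: "L > 1" by simp
    show ?case
    proof (intro allI impI)
      fix v :: real assume v: "v \<ge> 1 / L"
      have L1: "1 / L > 0" using L by simp
      then have v0: "v > 0" using v by linarith
      define r where "r = 2 * ln v + 1 - \<kappa>"
      show "4 * v * L / (2 * L + 2 * ln v + 1 - \<kappa>) \<le> v + v * ln v + 1 + (9 / 4) / L"
      \<comment> \<open>For v \<ge> e the crude bound 2 v of the left side is already covered by v +
        v ln v.\<close>
      proof (cases "v \<ge> exp 1")
        case True
        then have lnv: "ln v \<ge> 1" using v0 by (simp add: ln_ge_iff)
        have "4 * v * L / (2 * L + 2 * ln v + 1 - \<kappa>) \<le> 4 * v * L / (2 * L)"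
          using lnv \<kappa> L v0 by (intro divide_left_mono mult_pos_pos) auto
        also have "\<dots> = v + v * 1" using L by simp
        also have "\<dots> \<le> v + v * ln v" using lnv v0 by (intro add_left_mono mult_left_mono) auto
        finally have "4 * v * L / (2 * L + 2 * ln v + 1 - \<kappa>) \<le> v + v * ln v" .
        moreover have "0 \<le> (9 / 4) / L" using L by simp
        ultimately show ?thesis by linarith
      next
        case False
        have lnL: "ln L \<ge> 0" using L by simp
        have "ln v < ln (exp 1)" using False v0 by (subst ln_less_cancel_iff) auto
        moreover have "ln (1 / L) \<le> ln v" using v L1 v0 by (subst ln_le_cancel_iff)
        then have "- ln L \<le> ln v" using L by (simp add: ln_div)
        ultimately have rK: "\<bar>r\<bar> \<le> K L" unfolding r_def K_def using lnL unfolding ln_exp by linarith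
        define \<eta> where "\<eta> = r / (2 * L)"
        have KL: "K L < L" using elim(2) L by (simp add: field_simps)
        have \<eta>: "\<eta> \<ge> - (1 / 2)" unfolding \<eta>_def using rK KL L by (simp add: field_simps)
        have "4 * v * L / (2 * L + 2 * ln v + 1 - \<kappa>) = 4 * v * L / (2 * L * (1 + \<eta>))"
          unfolding \<eta>_def r_def using L by (simp add: distrib_left)
        also have "\<dots> = 2 * v * (1 / (1 + \<eta>))"
        proof -
          have "4 * v * L = (2 * L) * (2 * v)" by simp
          then have "4 * v * L / (2 * L * (1 + \<eta>)) = (2 * v) / (1 + \<eta>)"
            using L by (simp only: mult_divide_mult_cancel_left)
          then show ?thesis by simp
        qed
        also have "\<dots> \<le> 2 * v * (1 - \<eta> + 2 * \<eta>\<^sup>2)"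
          using v0 by (intro mult_left_mono inverse_one_plus_le[OF \<eta>]) auto
        also have "\<dots> = 2 * v - v * r / L + v * r\<^sup>2 / L\<^sup>2"
          unfolding \<eta>_def using L by (simp add: field_simps power2_eq_square)
        also have "v * r\<^sup>2 / L\<^sup>2 \<le> 3 * (K L)\<^sup>2 / L\<^sup>2"
        proof (intro divide_right_mono mult_mono)
          show "v \<le> 3" using False exp_le by linarith
          show "r\<^sup>2 \<le> (K L)\<^sup>2" using power_mono[OF rK, of 2] by simp
        qed auto
        also have "3 * (K L)\<^sup>2 / L\<^sup>2 = (3 * (K L)\<^sup>2 / L) / L" by (simp add: power2_eq_square)
        also have "\<dots> \<le> (1 / 4) / L" using elim(1) L by (intro divide_right_mono) auto
        finally have *: "4 * v * L / (2 * L + 2 * ln v + 1 - \<kappa>) \<le> 2 * v - v * r / L + (1 / 4) / L" by simp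
        have vl: "v - 1 \<le> v * ln v" by (rule mult_ln_ge[OF v0])
        have "v * \<kappa> \<le> v * 3" using \<kappa> v0 by (intro mult_left_mono) auto
        \<comment> \<open>This 2 and the second order 1/4 make up the coefficient 9/4.\<close>
        then have "- 2 \<le> v * r" using vl unfolding r_def by (simp add: algebra_simps)
        then have "- (v * r) / L \<le> 2 / L" using L by (intro divide_right_mono) auto
        then show ?thesis using * vl by (simp add: add_divide_distrib[symmetric])
      qed
    qed
  qed
qed

section \<open>Sums over the odd primes up to x, and the exponent\<close>

text \<open>The spare 1 accounts for the added coordinate: it gives ln (n + 1) \<le> ln x.\<close>

lemma card_odd_primes_upto_le:
  assumes x: "x \<ge> 1"
  shows "real (card (odd_primes_upto x)) + 1 \<le> x"
proof -
  have "odd_primes_upto x \<subseteq> {2..nat \<lfloor>x\<rfloor>}"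
    unfolding odd_primes_upto_def by (auto simp: le_nat_iff le_floor_iff dest: prime_ge_2_nat)
  then have "card (odd_primes_upto x) \<le> card {2..nat \<lfloor>x\<rfloor>}" by (intro card_mono) auto
  moreover have "1 \<le> nat \<lfloor>x\<rfloor>" using x by (simp add: le_nat_iff le_floor_iff)
  ultimately have "card (odd_primes_upto x) + 1 \<le> nat \<lfloor>x\<rfloor>" by simp
  then have "real (card (odd_primes_upto x) + 1) \<le> real (nat \<lfloor>x\<rfloor>)" by (rule of_nat_mono)
  also have "\<dots> \<le> x" using x by (intro of_nat_floor) simp
  finally show ?thesis by simp
qed

lemma log_prime_deficit_le:
  assumes x: "x > 1"
  shows "log_prime_deficit x \<le> card (odd_primes_upto x) * ln x"
proof -
  have "ln (x / real p) \<le> ln x" if "p \<in> odd_primes_upto x" for p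
    using odd_primes_upto_ge_3[OF that] x by (intro ln_mono) (auto simp: field_simps)
  then have "log_prime_deficit x \<le> (\<Sum>p\<in>odd_primes_upto x. ln x)"
    unfolding log_prime_deficit_def by (intro sum_mono)
  then show ?thesis by simp
qed

lemma sum_ln_odd_primes:
  assumes x: "x > 1"
  shows "(\<Sum>p\<in>odd_primes_upto x. ln (real p)) = card (odd_primes_upto x) * ln x - log_prime_deficit x"
proof -
  have "log_prime_deficit x = (\<Sum>p\<in>odd_primes_upto x. ln x - ln (real p))"
    unfolding log_prime_deficit_def using x
    by (intro sum.cong refl) (auto simp: ln_div dest: odd_primes_upto_ge_3)
  then show ?thesis by (simp add: sum_subtractf)
qed

text \<open>The tangent of ln at ln x. The deficit thereby counts a second time, with weight 1 / ln
  x.\<close>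

lemma sum_ln_ln_odd_primes:
  assumes x: "x > 1"
  shows "(\<Sum>p\<in>odd_primes_upto x. ln (ln (real p)))
    \<le> card (odd_primes_upto x) * ln (ln x) - log_prime_deficit x / ln x"
proof -
  have L: "ln x > 0" using x by simp
  have "ln (ln (real p)) \<le> ln (ln x) - ln (x / real p) / ln x" if p: "p \<in> odd_primes_upto x" for p
  proof -
    have p3: "real p \<ge> 3" using odd_primes_upto_ge_3[OF p] by simp
    have "ln (ln (real p)) - ln (ln x) \<le> (ln (real p) - ln x) / ln x"
      using p3 L by (intro ln_diff_le) auto
    also have "\<dots> = - ln (x / real p) / ln x" using p3 x by (simp add: ln_div)
    finally show ?thesis by simp
  qed
  then have "(\<Sum>p\<in>odd_primes_upto x. ln (ln (real p)))
      \<le> (\<Sum>p\<in>odd_primes_upto x. ln (ln x) - ln (x / real p) / ln x)"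
    by (intro sum_mono)
  then show ?thesis unfolding log_prime_deficit_def by (simp add: sum_subtractf sum_divide_distrib)
qed

lemma sum_ln_odd_primes_ge_card: "(\<Sum>p\<in>odd_primes_upto x. ln (real p)) \<ge> card (odd_primes_upto x)"
proof -
  have "1 \<le> ln (real p)" if "p \<in> odd_primes_upto x" for p
  proof -
    have "exp 1 \<le> real p" using exp_le odd_primes_upto_ge_3[OF that] by linarith
    then show ?thesis by (subst ln_ge_iff) (use odd_primes_upto_ge_3[OF that] in auto)
  qed
  then have "(\<Sum>p\<in>odd_primes_upto x. 1) \<le> (\<Sum>p\<in>odd_primes_upto x. ln (real p))" by (intro sum_mono)
  then show ?thesis by simp
qed

text \<open>The error C ln N is relative size C \<delta> ln N / N, so its logarithm times N stays of
  order ln N; passing from N = n + 1 to n costs no more than that.\<close>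

lemma ln_lattice_const_le:
  assumes \<delta>: "\<delta> > 0" and C: "C \<ge> 0" and n: "n \<ge> 1" and d: "d > 0"
    and le: "d \<le> real (n + 1) / \<delta> + C * ln (real (n + 1))"
  shows "real (n + 1) * ln d \<le> n * ln n - n * ln \<delta> + (1 + \<bar>ln \<delta>\<bar> + (1 + C * \<delta>) * ln (real (n + 1)))"
proof -
  define N where "N = real (n + 1)"
  have N: "N > 1" unfolding N_def using n by simp
  have lnN: "ln N \<ge> 0" using N by simp
  have pos: "0 \<le> C * \<delta> * ln N / N" using C \<delta> lnN N by (intro divide_nonneg_nonneg mult_nonneg_nonneg) auto
  have "N / \<delta> + C * ln N = N / \<delta> * (1 + C * \<delta> * ln N / N)" using \<delta> N by (simp add: field_simps)
  then have "ln d \<le> ln (N / \<delta> * (1 + C * \<delta> * ln N / N))"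
    using le d unfolding N_def by (intro ln_mono) auto
  also have "\<dots> = ln N - ln \<delta> + ln (1 + C * \<delta> * ln N / N)"
    using N \<delta> pos by (subst ln_mult) (auto simp: ln_div)
  also have "ln (1 + C * \<delta> * ln N / N) \<le> C * \<delta> * ln N / N"
    using pos by (rule ln_add_one_self_le_self)
  finally have "N * ln d \<le> N * (ln N - ln \<delta> + C * \<delta> * ln N / N)" using N by (intro mult_left_mono) auto
  also have "\<dots> = N * ln N - N * ln \<delta> + C * \<delta> * ln N" using N by (simp add: algebra_simps)
  finally have 1: "N * ln d \<le> N * ln N - N * ln \<delta> + C * \<delta> * ln N" .
  have "ln N - ln n \<le> (N - n) / n" unfolding N_def using n by (intro ln_diff_le) auto
  then have "n * (ln N - ln n) \<le> n * ((N - n) / n)" by (intro mult_left_mono) auto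
  also have "\<dots> = 1" unfolding N_def using n by simp
  finally have 2: "n * ln N \<le> n * ln n + 1" by (simp add: algebra_simps)
  have 3: "N * y = n * y + y" for y :: real unfolding N_def by (simp add: algebra_simps)
  have "- ln \<delta> \<le> \<bar>ln \<delta>\<bar>" by simp
  with 1 2 have "N * ln d \<le> n * ln n - n * ln \<delta> + (1 + \<bar>ln \<delta>\<bar> + (1 + C * \<delta>) * ln N)"
    unfolding 3[of "ln N"] 3[of "ln \<delta>"] by (simp add: algebra_simps)
  then show ?thesis unfolding N_def .
qed

text \<open>A prime contributes at most ln x to the deficit, so a large deficit forces many primes.
  This gives v \<ge> 1 / L and makes n grow with x.\<close>

lemma card_odd_primes_upto_ge:
  assumes x: "x > 1" and deficit: "log_prime_deficit x > x / ln x * (1 + 3 / 2 / ln x)"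
  shows "x / ln x \<le> card (odd_primes_upto x) * ln x"
proof -
  have "x / ln x * 1 \<le> x / ln x * (1 + 3 / 2 / ln x)" using x by (intro mult_left_mono) auto
  then show ?thesis using deficit log_prime_deficit_le[OF x] by linarith
qed

text \<open>With \<open>L = ln x\<close>, the choice \<open>M = (e / \<delta>) (n L)\<^sup>2\<close> is asymptotically optimal.\<close>

lemma exponent_bound:
  fixes x \<delta> C d :: real
  defines "L \<equiv> ln x" and "n \<equiv> card (odd_primes_upto x)"
  defines "M \<equiv> exp 1 / \<delta> * (real n * L)\<^sup>2"
  assumes \<delta>: "\<delta> > 0" and C: "C \<ge> 0" and x: "x > 1" and n: "n \<ge> 1" and d: "d > 0"
    and le: "d \<le> real (n + 1) / \<delta> + C * ln (real (n + 1))"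
    and deficit: "log_prime_deficit x > x / L * (1 + 3 / 2 / L)"
    and opt: "\<And>v. v \<ge> 1 / L \<Longrightarrow>
      4 * v * L / (2 * L + 2 * ln v + 1 - ln (2 * \<delta>)) \<le> v + v * ln v + 1 + (9 / 4) / L"
    and err: "(1 + \<bar>ln \<delta>\<bar> + (1 + C * \<delta>) * L + 2 * ln 2) * L\<^sup>2 / x \<le> 1 / 4"
  shows "4 * sqrt (\<delta> / exp 1 * M) / ln (M / 2) \<le> n * ln M - real (n + 1) * ln d
      - (\<Sum>p\<in>odd_primes_upto x. ln (ln (real p))) - (\<Sum>p\<in>odd_primes_upto x. ln (real p)) - 2 * ln 2"
proof -
  define F where "F = log_prime_deficit x"
  \<comment> \<open>The ratio of n to x / ln x.\<close>
  define v where "v = n * L / x"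
  define E where "E = 1 + \<bar>ln \<delta>\<bar> + (1 + C * \<delta>) * L + 2 * ln 2"
  have L: "L > 0" unfolding L_def using x by simp
  have F1: "F \<ge> x / L * (1 + 3 / 2 / L)" unfolding F_def using deficit by simp
  have nL: "x / L \<le> n * L"
    using card_odd_primes_upto_ge[OF x] deficit unfolding L_def n_def by simp
  have v: "v \<ge> 1 / L" unfolding v_def using nL L x by (simp add: field_simps)
  have v0: "v > 0" unfolding v_def using n L x by simp
  have nv: "n = x / L * v" unfolding v_def using L x by simp
  have lnv: "ln v = ln n + ln L - L" unfolding v_def using n L x by (simp add: ln_div ln_mult L_def)
  have lnM: "ln M = 1 - ln \<delta> + 2 * ln n + 2 * ln L"
    unfolding M_def using n L \<delta> by (simp add: ln_mult ln_div ln_realpow)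
  have M0: "M > 0" unfolding M_def using n L \<delta> by simp
  have lnM2: "ln (M / 2) = 2 * L + 2 * ln v + 1 - ln (2 * \<delta>)"
    using M0 \<delta> by (simp add: ln_div ln_mult lnM lnv)
  have "\<delta> / exp 1 * M = (real n * L)\<^sup>2" unfolding M_def using \<delta> by simp
  \<comment> \<open>M is the critical point of n ln M - 4 sqrt (\<delta> M / e) / ln M when ln M is
    treated as the constant 2 L.\<close>
  then have sq: "sqrt (\<delta> / exp 1 * M) = n * L" using L by simp
  have "4 * sqrt (\<delta> / exp 1 * M) / ln (M / 2) = x / L * (4 * v * L / (2 * L + 2 * ln v + 1 - ln (2 * \<delta>)))"
    unfolding sq lnM2 nv by (simp add: mult_ac)
  also have "\<dots> \<le> x / L * (v + v * ln v + 1 + (9 / 4) / L)"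
    using L x by (intro mult_left_mono opt v) auto
  finally have lhs: "4 * sqrt (\<delta> / exp 1 * M) / ln (M / 2) \<le> x / L * (v + v * ln v + 1 + (9 / 4) / L)" .
  have "ln (real (n + 1)) \<le> L" unfolding L_def
    using card_odd_primes_upto_le[of x] x by (intro ln_mono) (auto simp: n_def)
  then have "(1 + C * \<delta>) * ln (real (n + 1)) \<le> (1 + C * \<delta>) * L"
    using C \<delta> by (intro mult_left_mono) auto
  then have dle: "real (n + 1) * ln d \<le> n * ln n - n * ln \<delta> + E - 2 * ln 2"
    using ln_lattice_const_le[OF \<delta> C n d le] unfolding E_def by linarith
  have S: "(\<Sum>p\<in>odd_primes_upto x. ln (real p)) = n * L - F"
    unfolding n_def L_def F_def by (rule sum_ln_odd_primes[OF x])
  have W: "(\<Sum>p\<in>odd_primes_upto x. ln (ln (real p))) \<le> n * ln L - F / L"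
    unfolding n_def L_def F_def by (rule sum_ln_ln_odd_primes[OF x])
  have "E = x / L * (E * L\<^sup>2 / x / L)" using L x by (simp add: field_simps power2_eq_square)
  also have "\<dots> \<le> x / L * ((1 / 4) / L)"
    using err L x unfolding E_def by (intro mult_left_mono divide_right_mono) auto
  finally have E: "E \<le> x / L * ((1 / 4) / L)" .
  have "x / L * (v + v * ln v + 1 + (9 / 4) / L) \<le> n * (1 + ln v) + F * (1 + 1 / L) - E"
  proof -
    \<comment> \<open>5/2 = 3/2 + 1 from the deficit meets 9/4 from \<open>opt\<close> plus 1/4 from
      the error E.\<close>
    have "x / L * (1 + (5 / 2) / L) \<le> x / L * ((1 + 3 / 2 / L) * (1 + 1 / L))"
      using L x by (intro mult_left_mono) (auto simp: field_simps)
    also have "\<dots> = (x / L * (1 + 3 / 2 / L)) * (1 + 1 / L)" by simp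
    also have "\<dots> \<le> F * (1 + 1 / L)" using L by (intro mult_right_mono F1) auto
    finally have "x / L * (1 + (5 / 2) / L) \<le> F * (1 + 1 / L)" .
    moreover have "n * (1 + ln v) = x / L * (v + v * ln v)" unfolding nv
      by (simp only: distrib_left mult_1_right mult.assoc)
    moreover have "K * (A + 1 + (9 / 4) * y) = K * A + K * (1 + (5 / 2) * y) - K * ((1 / 4) * y)"
      for K A y :: real by (simp add: algebra_simps)
    from this[of "x / L" "v + v * ln v" "1 / L"]
    have "x / L * (v + v * ln v + 1 + (9 / 4) / L)
        = x / L * (v + v * ln v) + x / L * (1 + (5 / 2) / L) - x / L * ((1 / 4) / L)"
      by simp
    ultimately show ?thesis using E by linarith
  qed
  also have "\<dots> = n * ln M - (n * ln n - n * ln \<delta> + E - 2 * ln 2) - (n * ln L - F / L) - (n * L - F) - 2 * ln 2"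
    unfolding lnM lnv by (simp add: algebra_simps)
  also have "\<dots> \<le> n * ln M - real (n + 1) * ln d
      - (\<Sum>p\<in>odd_primes_upto x. ln (ln (real p))) - (\<Sum>p\<in>odd_primes_upto x. ln (real p)) - 2 * ln 2"
    using dle W unfolding S by simp
  finally show "4 * sqrt (\<delta> / exp 1 * M) / ln (M / 2) \<le> n * ln M - real (n + 1) * ln d
      - (\<Sum>p\<in>odd_primes_upto x. ln (ln (real p))) - (\<Sum>p\<in>odd_primes_upto x. ln (real p)) - 2 * ln 2"
    using lhs by linarith
qed

theorem theorem3p1:
  fixes \<delta> :: real
  assumes "\<delta> > 0"
    and "\<exists>g \<in> O(\<lambda>n. ln (real n)). \<forall>\<^sub>F n in sequentially.
           l1_lattice_const n \<le> real n / \<delta> + g n"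
  shows "infinite {(a, b, c). abc_triple a b c \<and>
           exp (4 * sqrt (2 * (\<delta> / exp 1) * ln (real c)) / ln (ln (real c)))
             * real (rad (a * b * c)) \<le> real c}"
proof
  note \<delta> = assms(1)
  let ?T = "{(a, b, c). abc_triple a b c \<and>
           exp (4 * sqrt (2 * (\<delta> / exp 1) * ln (real c)) / ln (ln (real c)))
             * real (rad (a * b * c)) \<le> real c}"
  assume fin: "finite ?T"
  \<comment> \<open>Finiteness would bound c, whereas the triple built below has c \<ge> exp n with
    n > B.\<close>
  define B where "B = Max ((\<lambda>(a, b, c). c) ` ?T)"
  have B: "c \<le> B" if "(a, b, c) \<in> ?T" for a b c
  proof -
    have "c \<in> (\<lambda>(a, b, c). c) ` ?T" using that by (rule rev_image_eqI) simp
    then show ?thesis unfolding B_def using fin by (intro Max_ge finite_imageI)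
  qed
  obtain g where g: "g \<in> O(\<lambda>n. ln (real n))"
    and ge: "\<forall>\<^sub>F n in sequentially. l1_lattice_const n \<le> real n / \<delta> + g n" using assms(2) by blast
  obtain C where C: "C > 0" and gC: "\<forall>\<^sub>F n in sequentially. norm (g n) \<le> C * norm (ln (real n))"
    using landau_o.bigE[OF g] by blast
  have const_le: "\<forall>\<^sub>F n in sequentially. l1_lattice_const n \<le> real n / \<delta> + C * ln (real n)"
    using ge gC eventually_ge_at_top[of 1] by eventually_elim auto
  then obtain n0 where n0: "\<And>n. n \<ge> n0 \<Longrightarrow> l1_lattice_const n \<le> real n / \<delta> + C * ln (real n)"
    unfolding eventually_sequentially by blast
  \<comment> \<open>Numerically, 2 \<delta> \<le> 12 < (5/2)^3 \<le> exp 3.\<close>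
  have \<kappa>: "ln (2 * \<delta>) \<le> 3"
  proof -
    have "1 + 1 + 1\<^sup>2 / 2 \<le> exp (1 :: real)" by (rule exp_lower_Taylor_quadratic) simp
    then have "(5 / 2) ^ 3 \<le> exp (1 :: real) ^ 3" by (intro power_mono) auto
    also have "\<dots> = exp 3" by (simp add: exp_of_nat_mult[symmetric])
    finally have "2 * \<delta> \<le> exp 3" using density_le_6[OF \<delta> const_le] by (simp add: power3_eq_cube)
    then have "ln (2 * \<delta>) \<le> ln (exp 3)" using \<delta> by (intro ln_mono) auto
    then show ?thesis by simp
  qed
  define err where "err x = (1 + \<bar>ln \<delta>\<bar> + (1 + C * \<delta>) * ln x + 2 * ln 2) * (ln x)\<^sup>2 / x" for x
  \<comment> \<open>One summand for each demand on n: the bound on the lattice constant, a c beyond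
    B, ln c \<ge> exp 2 for the monotonicity, and strictness.\<close>
  define n1 where "n1 = real n0 + real B + exp 2 + 1"
  have ln_top: "filterlim ln at_top (at_top :: real filter)" by (rule ln_at_top)
  have "(err \<longlongrightarrow> 0) at_top" unfolding err_def by real_asymp
  then have ev1: "\<forall>\<^sub>F x in at_top. err x < 1 / 4" by (rule order_tendstoD) simp
  have "filterlim (\<lambda>x :: real. x / (ln x)\<^sup>2) at_top at_top" by real_asymp
  then have ev2: "\<forall>\<^sub>F x :: real in at_top. n1 \<le> x / (ln x)\<^sup>2" unfolding filterlim_at_top by blast
  have ev3: "\<forall>\<^sub>F x in at_top. \<forall>v\<ge>1 / ln x.
    4 * v * ln x / (2 * ln x + 2 * ln v + 1 - ln (2 * \<delta>)) \<le> v + v * ln v + 1 + (9 / 4) / ln x"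
    by (rule eventually_compose_filterlim[OF optimisation_inequality[OF \<kappa>] ln_top])
  have "\<forall>\<^sub>F x in at_top. err x < 1 / 4 \<and> n1 \<le> x / (ln x)\<^sup>2 \<and> (\<forall>v\<ge>1 / ln x.
    4 * v * ln x / (2 * ln x + 2 * ln v + 1 - ln (2 * \<delta>)) \<le> v + v * ln v + 1 + (9 / 4) / ln x)"
    using ev1 ev2 ev3 by eventually_elim simp
  then obtain x0 where x0: "\<And>x. x \<ge> x0 \<Longrightarrow> err x < 1 / 4 \<and> n1 \<le> x / (ln x)\<^sup>2 \<and> (\<forall>v\<ge>1 / ln x.
    4 * v * ln x / (2 * ln x + 2 * ln v + 1 - ln (2 * \<delta>)) \<le> v + v * ln v + 1 + (9 / 4) / ln x)"
    unfolding eventually_at_top_linorder by blast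
  obtain x where x: "x \<ge> max x0 3" and deficit: "log_prime_deficit x > x / ln x * (1 + 3 / 2 / ln x)"
    using deficit_exceeds_infinitely_often by blast
  have x1: "x > 1" and xx0: "x \<ge> x0" using x by auto
  define P where "P = odd_primes_upto x"
  define n where "n = card P"
  define L where "L = ln x"
  define d where "d = l1_lattice_const (n + 1)"
  define M where "M = exp 1 / \<delta> * (real n * L)\<^sup>2"
  have L: "L > 0" unfolding L_def using x1 by simp
  have nL: "real n \<ge> x / L\<^sup>2"
    using card_odd_primes_upto_ge[OF x1 deficit] L unfolding n_def P_def L_def
    by (simp add: field_simps power2_eq_square)
  have n: "real n \<ge> n1" using nL x0[OF xx0] unfolding L_def by linarith
  then have nB: "n \<ge> n0" "n \<ge> 1" "n > B" "exp 2 \<le> real n"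
    unfolding n1_def using exp_gt_zero[of "2 :: real"] by linarith+
  have adm: "admissible_l1_const (n + 1) d" unfolding d_def by (rule l1_lattice_const_admissible) simp
  then have d0: "d > 0" unfolding admissible_l1_const_def by simp
  have dle: "d \<le> real (n + 1) / \<delta> + C * ln (real (n + 1))" unfolding d_def by (rule n0) (use nB in simp)
  define R where "R = 4 * sqrt (\<delta> / exp 1 * M) / ln (M / 2)"
  have M0: "M > 0" unfolding M_def using \<delta> nB L by simp
  have Rle: "R \<le> n * ln M - real (n + 1) * ln d - (\<Sum>p\<in>P. ln (ln (real p))) - (\<Sum>p\<in>P. ln (real p)) - 2 * ln 2"
    unfolding R_def M_def L_def n_def P_def
  proof (rule exponent_bound)
    show "\<And>v. v \<ge> 1 / ln x \<Longrightarrow> 4 * v * ln x / (2 * ln x + 2 * ln v + 1 - ln (2 * \<delta>))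
      \<le> v + v * ln v + 1 + (9 / 4) / ln x" using x0[OF xx0] by blast
    show "(1 + \<bar>ln \<delta>\<bar> + (1 + C * \<delta>) * ln x + 2 * ln 2) * (ln x)\<^sup>2 / x \<le> 1 / 4"
      using x0[OF xx0] unfolding err_def by linarith
  qed (use \<delta> C x1 d0 nB dle deficit in \<open>auto simp: n_def P_def\<close>)
  have prime: "prime p" if "p \<in> P" for p using that unfolding P_def odd_primes_upto_def by simp
  have "2 \<notin> P" unfolding P_def odd_primes_upto_def by simp
  have \<delta>6: "\<delta> \<le> 6" by (rule density_le_6[OF \<delta> const_le])
  \<comment> \<open>From here to \<open>R0\<close>: M \<ge> 16/3 > 2, so that ln (M / 2) and hence R
    are nonnegative. The factor 1/3 comes from e \<ge> 2 and \<delta> \<le> 6.\<close>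
  have "L \<ge> 1"
  proof -
    have "exp 1 \<le> x" using exp_le x by linarith
    then show ?thesis unfolding L_def using x1 by (simp add: ln_ge_iff)
  qed
  moreover have "real n \<ge> 4"
    using nB(4) exp_ge_add_one_self[of "2 :: real"] \<open>real n \<ge> n1\<close> unfolding n1_def by linarith
  ultimately have "4 * 1 \<le> real n * L" by (intro mult_mono) auto
  then have "4\<^sup>2 \<le> (real n * L)\<^sup>2" by (intro power_mono) auto
  moreover have "1 / 3 \<le> exp 1 / \<delta>"
    using exp_ge_add_one_self[of "1 :: real"] \<delta>6 \<delta> by (simp add: field_simps)
  ultimately have "1 / 3 * 4\<^sup>2 \<le> M" unfolding M_def using \<delta> by (intro mult_mono) auto
  then have R0: "R \<ge> 0" unfolding R_def using \<delta> by (intro divide_nonneg_nonneg) auto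
  obtain a b c where abc: "abc_triple a b c" "exp (\<Sum>p\<in>P. ln (real p)) \<le> real c" "2 * ln (real c) < M"
    "exp R * rad (a * b * c) \<le> real c"
    using abc_triple_from_primes[OF _ prime \<open>2 \<notin> P\<close> _ M0 R0, of d] adm Rle
    unfolding n_def P_def by auto
  have "exp (real n) \<le> exp (\<Sum>p\<in>P. ln (real p))"
    unfolding n_def P_def using sum_ln_odd_primes_ge_card by simp
  then have cn: "exp (real n) \<le> real c" using abc(2) by linarith
  then have c0: "real c > 0" using exp_gt_zero[of "real n"] by linarith
  have "real n \<le> ln (real c)" using cn c0 by (simp add: ln_ge_iff)
  then have u: "exp 2 \<le> ln (real c)" using nB(4) by linarith
  \<comment> \<open>The exponent of the claim increases with ln c, and at ln c = M / 2 it equals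
    R.\<close>
  have "4 * sqrt (2 * (\<delta> / exp 1) * ln (real c)) / ln (ln (real c))
      = 4 * sqrt (2 * (\<delta> / exp 1)) * (sqrt (ln (real c)) / ln (ln (real c)))"
    unfolding real_sqrt_mult[of "2 * (\<delta> / exp 1)"] by simp
  also have "\<dots> \<le> 4 * sqrt (2 * (\<delta> / exp 1)) * (sqrt (M / 2) / ln (M / 2))"
    using abc(3) u \<delta> by (intro mult_left_mono sqrt_over_ln_mono) auto
  also have "\<dots> = R"
  proof -
    have "sqrt (2 * (\<delta> / exp 1)) * sqrt (M / 2) = sqrt (\<delta> / exp 1 * M)"
      unfolding real_sqrt_mult[symmetric] by simp
    then show ?thesis unfolding R_def by simp
  qed
  finally have "exp (4 * sqrt (2 * (\<delta> / exp 1) * ln (real c)) / ln (ln (real c))) * real (rad (a * b * c))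
      \<le> exp R * rad (a * b * c)" by (intro mult_right_mono) auto
  then have "(a, b, c) \<in> ?T" using abc(1,4) by simp
  then have "c \<le> B" by (rule B)
  moreover have "real n < exp (real n)" using exp_ge_add_one_self[of "real n"] by linarith
  ultimately show False using cn nB(3) by linarith
qed

end
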